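(* Let $p\geq 5$ be an odd integer and $s=\frac2p$. There exist integers $n_0,n_1>0$ such that $[A_{n,s}^{-1}]=\left[2\left(n-\frac12\right)^s\right]$ for every even integer $n\geq n_0$, and $[B_{n,s}^{-1}]=\left[-2\left(n-\frac12\right)^s\right]$ for every odd integer $n\geq n_1$.
   Context: For an integer $n\geq1$ and real $0<s<1$: $A_{n,s}=\left(\frac{1}{n^s}-\frac{1}{(n+1)^s}\right)+\left(\frac{1}{(n+2)^s}-\frac{1}{(n+3)^s}\right)+\cdots$ and $B_{n,s}=\left(-\frac{1}{n^s}+\frac{1}{(n+1)^s}\right)+\left(-\frac{1}{(n+2)^s}+\frac{1}{(n+3)^s}\right)+\cdots$. $[x]$ denotes the integer part (floor) of $x$. *)

theory Defs
  imports "HOL-Analysis.Analysis"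
begin

definition A_ns :: "nat \<Rightarrow> real \<Rightarrow> real" where
  "A_ns n s = (\<Sum>k. (1 / real (n + 2*k) powr s - 1 / real (n + 2*k + 1) powr s))"

definition B_ns :: "nat \<Rightarrow> real \<Rightarrow> real" where
  "B_ns n s = (\<Sum>k. (- 1 / real (n + 2*k) powr s + 1 / real (n + 2*k + 1) powr s))"

end

theory Submission
  imports Defs "HOL-Computational_Algebra.Polynomial_FPS"
begin

text \<open>Write \<open>m = n - 1/2\<close>. Comparing derivatives and telescoping gives
  \<open>2 m\<^sup>s \<le> 1 / A\<^sub>n \<le> 2 (m\<^sup>2 + 25)\<^sup>s\<^sup>/\<^sup>2\<close>, so a failure of either floor identity produces
  an integer \<open>k\<close> with \<open>k\<^sup>p = 2\<^sup>p\<^sup>-\<^sup>2 (2 n - 1)\<^sup>2 + d\<close> and \<open>0 \<le> d \<le> 25 \<cdot> 2\<^sup>p\<close>.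
  The case \<open>d = 0\<close> is excluded at the prime 2, and for each of the finitely many other \<open>d\<close>
  the equation has finitely many solutions.

  The latter is a form of Thue's theorem for \<open>X\<^sup>2 + D = a k\<^sup>p\<close>. Put \<open>\<beta> = X + \<surd>(-D)\<close>.
  A pigeonhole argument shows \<open>a \<xi>\<^sup>p = \<gamma> \<beta>\<close> with \<open>\<xi>, \<gamma>\<close> in \<open>\<int>[\<surd>(-D)]\<close> and \<open>\<gamma>\<close> from a
  finite set. Hence infinitely many solutions would share one \<open>\<gamma>\<close>, and their quotients
  \<open>\<xi> / cnj \<xi>\<close> would approximate each other extremely well. Fixing one large solution \<open>\<beta>\<^sub>0\<close>, the
  Pade approximants of \<open>(1 + w)\<^sup>-\<^sup>1\<^sup>/\<^sup>p\<close> at \<open>w = cnj \<beta>\<^sub>0 / \<beta>\<^sub>0 - 1\<close> yield a nonzero element of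
  \<open>\<int>[\<surd>(-D)]\<close> of absolute value less than 1, a contradiction.\<close>

section \<open>Pade approximants of the binomial series\<close>

text \<open>Up to the factor \<open>(2 * r) choose r\<close> this is the hypergeometric polynomial
  2F1(-r, -r - \<nu>; -2r; -w), the denominator of the diagonal Pade approximant of (1 +
  w)^(-\<nu>). In this scaling each coefficient is an integer times a binomial coefficient of r +
  \<nu>.\<close>

definition pade_denom :: "'a::field_char_0 \<Rightarrow> nat \<Rightarrow> 'a poly" where
  "pade_denom \<nu> r =
     (\<Sum>j\<le>r. monom (of_nat ((2 * r - j) choose r) * ((of_nat r + \<nu>) gchoose j)) j)"

definition pade_series :: "'a::field_char_0 \<Rightarrow> nat \<Rightarrow> 'a fps" where
  "pade_series \<nu> r = fps_of_poly (pade_denom \<nu> r) * fps_binomial (- \<nu>)"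

definition pade_numer :: "'a::field_char_0 \<Rightarrow> nat \<Rightarrow> 'a poly" where
  "pade_numer \<nu> r = (\<Sum>n\<le>r. monom (fps_nth (pade_series \<nu> r) n) n)"

lemma coeff_pade_denom:
  "coeff (pade_denom \<nu> r) j =
     (if j \<le> r then of_nat ((2 * r - j) choose r) * ((of_nat r + \<nu>) gchoose j) else 0)"
  by (simp add: pade_denom_def coeff_sum if_distrib[of "\<lambda>x. coeff x j"] cong: if_cong)

lemma coeff_pade_numer:
  "coeff (pade_numer \<nu> r) n = (if n \<le> r then fps_nth (pade_series \<nu> r) n else 0)"
  by (simp add: pade_numer_def coeff_sum)

lemma degree_pade_denom: "degree (pade_denom \<nu> r) \<le> r"
  by (rule degree_le) (auto simp: coeff_pade_denom)

lemma degree_pade_numer: "degree (pade_numer \<nu> r) \<le> r"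
  by (rule degree_le) (auto simp: coeff_pade_numer)

text \<open>The factor C(2r - j, r) is a polynomial of degree r in j, hence a combination of the
  C(j, i) with i \<le> r. For a single C(j, i), trinomial revision and Vandermonde collapse the sum
  to C(r + \<nu>, i) C(r - i, n - i), which is 0 because n > r.\<close>

lemma gbinomial_convolution_eq_0:
  fixes \<nu> :: "'a::field_char_0"
  assumes "r < n"
  shows "(\<Sum>j\<le>n. (of_nat (2 * r) - of_nat j gchoose r) * (of_nat r + \<nu> gchoose j)
            * (- \<nu> gchoose (n - j))) = 0"
proof -
  \<comment> \<open>Reflection gives C(2r - j, r) = (-1)^r C(j - r - 1, r); Vandermonde for j + (-r
    - 1) then yields these coefficients.\<close>
  define q :: "nat \<Rightarrow> 'a" where "q i = (-1)^r * (- of_nat r - 1 gchoose (r - i))" for i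
  have Q: "(of_nat (2 * r) - of_nat j gchoose r) = (\<Sum>i\<le>r. q i * of_nat (j choose i))" for j
  proof -
    have "(of_nat (2 * r) - of_nat j gchoose r) = (-1)^r * ((of_nat j + (- of_nat r - 1) gchoose r) :: 'a)"
      using gbinomial_minus[of "of_nat j - of_nat (2*r) :: 'a" r] by (simp add: algebra_simps)
    also have "(of_nat j + (- of_nat r - 1) gchoose r) =
        (\<Sum>i\<le>r. (of_nat j gchoose i) * (- of_nat r - 1 gchoose (r - i)) :: 'a)"
      by (metis atLeast0AtMost gbinomial_Vandermonde)
    finally show ?thesis
      by (simp add: q_def sum_distrib_left binomial_gbinomial mult_ac)
  qed
  have inner: "(\<Sum>j\<le>n. of_nat (j choose i) * (of_nat r + \<nu> gchoose j) * (- \<nu> gchoose (n - j))) = 0"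
    if "i \<le> r" for i
  proof -
    have "(\<Sum>j\<le>n. of_nat (j choose i) * (of_nat r + \<nu> gchoose j) * (- \<nu> gchoose (n - j))) =
          (\<Sum>j=i..n. of_nat (j choose i) * (of_nat r + \<nu> gchoose j) * (- \<nu> gchoose (n - j)))"
      by (rule sum.mono_neutral_right) auto
    also have "\<dots> = (\<Sum>j=i..n. (of_nat r + \<nu> gchoose i) *
                    ((of_nat r + \<nu> - of_nat i gchoose (j - i)) * (- \<nu> gchoose (n - j))))"
    proof (rule sum.cong)
      fix j assume "j \<in> {i..n}"
      then have "(of_nat r + \<nu> gchoose j) * of_nat (j choose i) =
          (of_nat r + \<nu> gchoose i) * (of_nat r + \<nu> - of_nat i gchoose (j - i))"
        by (simp add: binomial_gbinomial gbinomial_trinomial_revision)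
      then show "of_nat (j choose i) * (of_nat r + \<nu> gchoose j) * (- \<nu> gchoose (n - j)) =
        (of_nat r + \<nu> gchoose i) * ((of_nat r + \<nu> - of_nat i gchoose (j - i)) * (- \<nu> gchoose (n - j)))"
        by (simp only: mult.assoc[symmetric] mult.commute[of "of_nat (j choose i)"])
    qed simp
    also have "\<dots> = (of_nat r + \<nu> gchoose i) *
       (\<Sum>j=0..n - i. (of_nat r + \<nu> - of_nat i gchoose j) * (- \<nu> gchoose (n - i - j)))"
      unfolding sum_distrib_left[symmetric]
      using sum.shift_bounds_cl_nat_ivl[of
          "\<lambda>j. (of_nat r + \<nu> - of_nat i gchoose (j - i)) * (- \<nu> gchoose (n - j))" 0 i "n - i"]
        that assms by (simp add: algebra_simps)
    also have "(\<Sum>j=0..n - i. (of_nat r + \<nu> - of_nat i gchoose j) * (- \<nu> gchoose (n - i - j))) =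
        (of_nat r + \<nu> - of_nat i + - \<nu> gchoose (n - i))"
      by (rule gbinomial_Vandermonde)
    also have "of_nat r + \<nu> - of_nat i + - \<nu> = of_nat (r - i)"
      using that by (simp add: of_nat_diff)
    also have "(of_nat (r - i) gchoose (n - i) :: 'a) = of_nat ((r - i) choose (n - i))"
      by (simp add: binomial_gbinomial)
    also have "(r - i) choose (n - i) = 0"
      using that assms by (intro binomial_eq_0) auto
    finally show ?thesis by simp
  qed
  have "(\<Sum>j\<le>n. (of_nat (2 * r) - of_nat j gchoose r) * (of_nat r + \<nu> gchoose j) * (- \<nu> gchoose (n - j)))
      = (\<Sum>j\<le>n. \<Sum>i\<le>r. q i * (of_nat (j choose i) * (of_nat r + \<nu> gchoose j) * (- \<nu> gchoose (n - j))))"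
    unfolding Q sum_distrib_right by (simp add: mult_ac)
  also have "\<dots> = (\<Sum>i\<le>r. q i * (\<Sum>j\<le>n. of_nat (j choose i) * (of_nat r + \<nu> gchoose j) * (- \<nu> gchoose (n - j))))"
    by (subst sum.swap) (simp add: sum_distrib_left)
  also have "\<dots> = 0"
    using inner by simp
  finally show ?thesis .
qed

lemma pade_series_nth:
  "fps_nth (pade_series \<nu> r) n =
     (\<Sum>j\<le>n. coeff (pade_denom \<nu> r) j * (- \<nu> gchoose (n - j)))"
  by (simp add: pade_series_def fps_mult_nth atLeast0AtMost)

text \<open>For r < j \<le> 2r the binomial coefficient vanishes by itself, so up to index 2r the
  cut at r is invisible and the convolution identity applies.\<close>

lemma coeff_pade_denom_gbinomial:
  assumes "j \<le> 2 * r"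
  shows "coeff (pade_denom \<nu> r) j =
     (of_nat (2 * r) - of_nat j gchoose r) * (of_nat r + \<nu> gchoose j)"
proof -
  have "(of_nat (2 * r) - of_nat j gchoose r) = (of_nat ((2 * r - j) choose r) :: 'a)"
    using assms by (simp add: binomial_gbinomial of_nat_diff)
  moreover have "(2 * r - j) choose r = 0" if "\<not> j \<le> r"
    using that assms by (intro binomial_eq_0) auto
  ultimately show ?thesis by (simp add: coeff_pade_denom)
qed

lemma pade_series_nth_eq_0:
  assumes "r < n" "n \<le> 2 * r"
  shows "fps_nth (pade_series \<nu> r) n = 0"
  using gbinomial_convolution_eq_0[OF assms(1), of \<nu>] assms(2)
  by (simp add: pade_series_nth coeff_pade_denom_gbinomial)

text \<open>The convolution identity also covers n = 2r + 1, but its last summand carries C(-1, r) =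
  (-1)^r, whereas \<open>pade_denom\<close> has no such coefficient. What remains is minus that
  summand; it is the leading coefficient of the remainder.\<close>

lemma pade_series_nth_first:
  "fps_nth (pade_series \<nu> r) (2 * r + 1) = - ((-1) ^ r * (of_nat r + \<nu> gchoose (2 * r + 1)))"
proof -
  let ?g = "\<lambda>j. (of_nat (2 * r) - of_nat j gchoose r) * (of_nat r + \<nu> gchoose j)
            * (- \<nu> gchoose (2 * r + 1 - j))"
  have "0 = (\<Sum>j\<le>2 * r + 1. ?g j)"
    by (rule gbinomial_convolution_eq_0[symmetric]) simp
  also have "\<dots> = (\<Sum>j\<le>2 * r. ?g j) + ?g (2 * r + 1)"
    by simp
  also have "?g (2 * r + 1) = (-1) ^ r * (of_nat r + \<nu> gchoose (2 * r + 1))"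
    using gbinomial_minus[of "1::'a" r] by (simp add: binomial_gbinomial[symmetric])
  also have "(\<Sum>j\<le>2 * r. ?g j) = fps_nth (pade_series \<nu> r) (2 * r + 1)"
    unfolding pade_series_nth by (simp add: coeff_pade_denom_gbinomial coeff_pade_denom[of _ _ "Suc (2 * r)"])
  finally show ?thesis
    by (simp add: add_eq_0_iff2)
qed

lemma pade_series_decomp:
  "pade_series \<nu> r = fps_of_poly (pade_numer \<nu> r) + fps_X ^ (2 * r + 1) * fps_shift (2 * r + 1) (pade_series \<nu> r)"
proof (rule fps_ext)
  fix n :: nat
  show "fps_nth (pade_series \<nu> r) n = fps_nth (fps_of_poly (pade_numer \<nu> r) + fps_X ^ (2 * r + 1) * fps_shift (2 * r + 1) (pade_series \<nu> r)) n"
    using pade_series_nth_eq_0[of r n \<nu>]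
    by (auto simp: coeff_pade_numer fps_X_power_mult_nth simp del: power_Suc power_add)
qed

text \<open>Substituting A_k = B_k f - X^(2k+1) S_k with f = (1 + X)^(-\<nu>) cancels f and leaves a
  multiple of X^(2r+1), while the degree is at most 2r + 1. Hence consecutive approximants are
  linearly independent at every nonzero point.\<close>

lemma pade_wronskian:
  fixes \<nu> :: "'a::field_char_0"
  assumes "\<nu> \<notin> \<int>"
  shows "\<exists>c. c \<noteq> 0 \<and> pade_numer \<nu> r * pade_denom \<nu> (Suc r) - pade_numer \<nu> (Suc r) * pade_denom \<nu> r
           = monom c (2 * r + 1)"
proof -
  define A where "A = pade_numer \<nu>"
  define B where "B = pade_denom \<nu>"
  define S where "S r = fps_shift (2 * r + 1) (pade_series \<nu> r)" for r
  let ?P = "A r * B (Suc r) - A (Suc r) * B r"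
  let ?T = "S (Suc r) * fps_X ^ 2 * fps_of_poly (B r) - S r * fps_of_poly (B (Suc r))"
  have dec: "fps_of_poly (A k) = fps_of_poly (B k) * fps_binomial (- \<nu>) - fps_X ^ (2 * k + 1) * S k" for k
    using pade_series_decomp[of \<nu> k] unfolding S_def A_def B_def
    by (simp add: pade_series_def algebra_simps)
  have "fps_of_poly ?P = fps_X ^ (2 * r + 1) * ?T"
    unfolding fps_of_poly_diff fps_of_poly_mult dec
    by (simp add: algebra_simps power2_eq_square)
  then have co: "coeff ?P n = (if n < 2 * r + 1 then 0 else fps_nth ?T (n - (2 * r + 1)))" for n
    using fps_of_poly_nth[of ?P n] fps_X_power_mult_nth[of "2 * r + 1" ?T n] by (simp only: )
  define c where "c = fps_nth ?T 0"
  \<comment> \<open>At 0 only - S_r B_(r+1) survives: the first remainder coefficient times C(2r +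
    2, r + 1).\<close>
  have T: "c = (-1) ^ r * (of_nat r + \<nu> gchoose (2 * r + 1)) * of_nat ((2 * r + 2) choose (r + 1))"
    using pade_series_nth_first[of \<nu> r]
    by (simp add: c_def S_def B_def coeff_pade_denom)
  have "(of_nat r + \<nu> gchoose (2 * r + 1)) \<noteq> 0"
  proof -
    have "of_nat r + \<nu> - of_nat i \<noteq> 0" for i
    proof
      assume "of_nat r + \<nu> - of_nat i = 0"
      then have "\<nu> = of_int (int i - int r)" by (simp add: algebra_simps)
      then show False using assms by (metis Ints_of_int)
    qed
    then have "(\<Prod>i = 0..<2 * r + 1. of_nat r + \<nu> - of_nat i) \<noteq> 0"
      by (simp del: prod.op_ivl_Suc)
    then show ?thesis
      by (metis gbinomial_mult_fact mult_zero_right)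
  qed
  then have c: "c \<noteq> 0" by (simp add: T del: binomial_Suc_Suc)
  have "degree ?P \<le> 2 * r + 1"
  proof (rule degree_diff_le)
    show "degree (A r * B (Suc r)) \<le> 2 * r + 1"
      using degree_mult_le[of "A r" "B (Suc r)"] degree_pade_numer[of \<nu> r] degree_pade_denom[of \<nu> "Suc r"]
      unfolding A_def B_def by linarith
    show "degree (A (Suc r) * B r) \<le> 2 * r + 1"
      using degree_mult_le[of "A (Suc r)" "B r"] degree_pade_numer[of \<nu> "Suc r"] degree_pade_denom[of \<nu> r]
      unfolding A_def B_def by linarith
  qed
  then have high: "coeff ?P n = 0" if "n > 2 * r + 1" for n
    using that by (intro coeff_eq_0) auto
  have "?P = monom c (2 * r + 1)"
  proof (rule poly_eqI)
    fix n
    consider "n < 2 * r + 1" | "n = 2 * r + 1" | "n > 2 * r + 1" by linarith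
    then show "coeff ?P n = coeff (monom c (2 * r + 1)) n"
      by cases (use co[of n] high[of n] in \<open>simp_all only: c_def coeff_monom if_True if_False, simp_all\<close>)
  qed
  with c show ?thesis unfolding A_def B_def by blast
qed

section \<open>Denominators of the Pade coefficients\<close>

definition binomial_denominator :: "nat \<Rightarrow> 'a::field_char_0 \<Rightarrow> bool" where
  "binomial_denominator q x \<longleftrightarrow> (\<forall>j. of_nat q ^ j * (x gchoose j) \<in> \<int>)"

text \<open>The condition says that (1 + qX)^x has integer coefficients. Integral series are closed
  under products, which is Vandermonde with q^j split as q^i q^(j-i).\<close>

lemma binomial_denominator_add:
  assumes "binomial_denominator q x" "binomial_denominator q y"
  shows "binomial_denominator q (x + y)"
  unfolding binomial_denominator_def
proof
  fix j
  have "of_nat q ^ j * (x + y gchoose j) =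
      (\<Sum>i=0..j. (of_nat q ^ i * (x gchoose i)) * (of_nat q ^ (j - i) * (y gchoose (j - i))))"
    unfolding gbinomial_Vandermonde[symmetric] sum_distrib_left
  proof (rule sum.cong)
    fix i assume "i \<in> {0..j}"
    then have "of_nat q ^ j = (of_nat q ^ i * of_nat q ^ (j - i) :: 'a)"
      by (simp add: power_add[symmetric])
    then show "of_nat q ^ j * ((x gchoose i) * (y gchoose (j - i))) =
        of_nat q ^ i * (x gchoose i) * (of_nat q ^ (j - i) * (y gchoose (j - i)))"
      by simp
  qed simp
  also have "\<dots> \<in> \<int>"
    by (rule Ints_sum, rule Ints_mult)
      (rule assms[unfolded binomial_denominator_def, rule_format])+
  finally show "of_nat q ^ j * (x + y gchoose j) \<in> \<int>" .
qed

lemma binomial_denominator_of_nat: "binomial_denominator q (of_nat n)"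
  by (simp add: binomial_denominator_def binomial_gbinomial[symmetric] Ints_mult)

lemma binomial_denominator_minus_one: "binomial_denominator q (- 1 :: 'a::field_char_0)"
proof -
  have "((- 1 :: 'a) gchoose j) = (-1) ^ j" for j
    using gbinomial_minus[of "1::'a" j] by (simp add: binomial_gbinomial[symmetric])
  then show ?thesis by (simp add: binomial_denominator_def Ints_mult Ints_power)
qed

lemma binomial_denominator_of_nat_mult:
  assumes "binomial_denominator q x"
  shows "binomial_denominator q (of_nat n * x)"
proof (induction n)
  case 0
  then show ?case using binomial_denominator_of_nat[of q 0] by simp
next
  case (Suc n)
  then show ?case using binomial_denominator_add[OF assms Suc.IH] by (simp add: ring_distribs)
qed

lemma fps_power_nth_in_Ints:
  fixes g :: "'a::field_char_0 fps"
  assumes "\<And>m. m < n \<Longrightarrow> fps_nth g m \<in> \<int>" "m < n"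
  shows "fps_nth (g ^ k) m \<in> \<int>"
  using assms(2)
proof (induction k arbitrary: m)
  case 0
  then show ?case by auto
next
  case (Suc k)
  show ?case
    unfolding power_Suc fps_mult_nth
    by (rule Ints_sum, rule Ints_mult[OF assms(1) Suc.IH]) (use Suc.prems in auto)
qed

text \<open>The power series \<open>(1 + p\<^sup>2 X)\<^sup>1\<^sup>/\<^sup>p = 1 + p g\<close> satisfies
  \<open>g = X - (\<Sum>k = 2..p. (p choose k) p\<^sup>k\<^sup>-\<^sup>2 g\<^sup>k)\<close>, which determines the
  coefficients of \<open>g\<close> recursively as integers.\<close>

lemma binomial_denominator_inverse:
  assumes p: "p > 0"
  shows "binomial_denominator (p\<^sup>2) (1 / of_nat p :: 'a::field_char_0)"
proof -
  define t :: "'a fps" where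
    "t = fps_binomial (1 / of_nat p) oo (fps_const (of_nat (p\<^sup>2)) * fps_X)"
  define g where "g = fps_const (1 / of_nat p) * (t - 1)"
  have t_nth: "fps_nth t n = of_nat (p\<^sup>2) ^ n * (1 / of_nat p gchoose n)" for n
    by (simp add: t_def fps_compose_linear)
  have "fps_binomial (1 / of_nat p :: 'a) ^ p = 1 + fps_X"
    using p by (simp add: fps_binomial_power fps_binomial_1)
  then have "t ^ p = (1 + fps_X) oo (fps_const (of_nat (p\<^sup>2)) * fps_X)"
    unfolding t_def by (subst fps_compose_power) auto
  then have tp: "t ^ p = 1 + fps_const (of_nat (p\<^sup>2)) * fps_X"
    by (simp add: fps_compose_add_distrib)
  have tg: "t = fps_const (of_nat p) * g + 1"
    using p by (simp add: g_def mult.assoc[symmetric] fps_const_mult[symmetric] del: fps_const_mult)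
       (simp add: fps_const_mult)
  have "t ^ p = (\<Sum>k\<le>p. of_nat (p choose k) * (fps_const (of_nat p) * g) ^ k)"
    unfolding tg by (simp add: binomial_ring)
  also have "\<dots> = (\<Sum>k\<in>{0,1} \<union> {2..p}. of_nat (p choose k) * (fps_const (of_nat p) * g) ^ k)"
    by (rule sum.cong) (use p in auto)
  also have "\<dots> = 1 + fps_const (of_nat (p\<^sup>2)) * g
       + (\<Sum>k=2..p. of_nat (p choose k) * (fps_const (of_nat p) * g) ^ k)"
    by (subst sum.union_disjoint)
       (auto simp: power2_eq_square mult.assoc[symmetric] fps_of_nat fps_const_mult[symmetric]
             simp del: fps_const_mult)
  also have "(\<Sum>k=2..p. of_nat (p choose k) * (fps_const (of_nat p) * g) ^ k)
     = fps_const (of_nat (p\<^sup>2)) * (\<Sum>k=2..p. fps_const (of_nat ((p choose k) * p ^ (k - 2))) * g ^ k)"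
    unfolding sum_distrib_left
  proof (rule sum.cong)
    fix k assume "k \<in> {2..p}"
    then have "p ^ k = p\<^sup>2 * p ^ (k - 2)"
      by (metis atLeastAtMost_iff le_add_diff_inverse power_add)
    then have "of_nat (p choose k) * of_nat p ^ k =
        (of_nat (p\<^sup>2) * of_nat ((p choose k) * p ^ (k - 2)) :: 'a)"
      by (metis (no_types) mult.left_commute of_nat_mult of_nat_power)
    then show "of_nat (p choose k) * (fps_const (of_nat p) * g) ^ k =
        fps_const (of_nat (p\<^sup>2)) * (fps_const (of_nat ((p choose k) * p ^ (k - 2))) * g ^ k)"
      by (simp only: power_mult_distrib fps_of_nat[symmetric] mult.assoc[symmetric] fps_const_mult
          fps_const_power)
  qed simp
  finally have "fps_const (of_nat (p\<^sup>2)) * fps_X = fps_const (of_nat (p\<^sup>2)) *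
      (g + (\<Sum>k=2..p. fps_const (of_nat ((p choose k) * p ^ (k - 2))) * g ^ k))"
    using tp by (simp add: algebra_simps)
  then have gX: "fps_X = g + (\<Sum>k=2..p. fps_const (of_nat ((p choose k) * p ^ (k - 2))) * g ^ k)"
    using p by simp
  have g0: "fps_nth g 0 = 0"
    using t_nth[of 0] by (simp add: g_def)
  have gint: "fps_nth g n \<in> \<int>" for n
  proof (induction n rule: less_induct)
    case (less n)
    have pow: "fps_nth (g ^ k) n \<in> \<int>" if "k \<ge> 2" for k
    proof -
      define l where "l = k - 2"
      then have l: "k = Suc (Suc l)"
        using that by simp
      have "fps_nth (g ^ k) n = (\<Sum>i=0..n. fps_nth g i * fps_nth (g ^ Suc l) (n - i))"
        unfolding l by (subst power_Suc) (simp only: fps_mult_nth)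
      also have "\<dots> \<in> \<int>"
      proof (rule Ints_sum)
        fix i assume i: "i \<in> {0..n}"
        \<comment> \<open>As g has constant term 0, the summands for i = 0 and i = n vanish, so only
          coefficients of g with index below n enter.\<close>
        consider "i = 0" | "i = n" "i > 0" | "0 < i" "i < n" using i by fastforce
        then show "fps_nth g i * fps_nth (g ^ Suc l) (n - i) \<in> \<int>"
        proof cases
          case 3
          then show ?thesis
            by (intro Ints_mult[OF less.IH fps_power_nth_in_Ints[OF less.IH]]) auto
        qed (use g0 in auto)
      qed
      finally show ?thesis .
    qed
    have "fps_nth g n = fps_nth fps_X n -
       (\<Sum>k=2..p. of_nat ((p choose k) * p ^ (k - 2)) * fps_nth (g ^ k) n)"
      using arg_cong[OF gX, of "\<lambda>f. fps_nth f n"] by (simp add: fps_sum_nth algebra_simps)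
    also have "\<dots> \<in> \<int>"
    proof (rule Ints_diff, goal_cases)
      case 1
      then show ?case by (simp add: fps_X_def)
    next
      case 2
      show ?case by (rule Ints_sum, rule Ints_mult[OF Ints_of_nat pow]) simp
    qed
    finally show ?case .
  qed
  have "fps_nth t n \<in> \<int>" for n
    unfolding tg using gint[of n] by (auto intro!: Ints_add Ints_mult)
  then show ?thesis
    unfolding binomial_denominator_def t_nth by blast
qed

lemma binomial_denominator_pade:
  fixes p r :: nat
  assumes p: "p > 0"
  defines "\<nu> \<equiv> 1 / of_nat p :: 'a::field_char_0"
  shows "binomial_denominator (p\<^sup>2) (of_nat r + \<nu>)" "binomial_denominator (p\<^sup>2) (- \<nu>)"
proof -
  note inv = binomial_denominator_inverse[OF p, where 'a = 'a, folded \<nu>_def]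
  show "binomial_denominator (p\<^sup>2) (of_nat r + \<nu>)"
    by (intro binomial_denominator_add binomial_denominator_of_nat inv)
  \<comment> \<open>Written this way, closure under addition suffices for the negative
    exponent.\<close>
  have "- \<nu> = of_nat (p - 1) * \<nu> + - 1"
    using p by (simp add: \<nu>_def field_simps of_nat_diff)
  then show "binomial_denominator (p\<^sup>2) (- \<nu>)"
    by (metis binomial_denominator_add binomial_denominator_minus_one
        binomial_denominator_of_nat_mult inv)
qed

lemma pade_denom_in_Ints:
  assumes "p > 0"
  shows "of_nat (p\<^sup>2) ^ j * coeff (pade_denom (1 / of_nat p :: 'a::field_char_0) r) j \<in> \<int>"
  using binomial_denominator_pade(1)[OF assms, where 'a = 'a and r = r]
  unfolding binomial_denominator_def coeff_pade_denom
  by (auto simp: mult.left_commute[of "of_nat (p\<^sup>2) ^ j"] simp del: of_nat_power intro: Ints_mult)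

lemma pade_numer_in_Ints:
  assumes "p > 0"
  shows "of_nat (p\<^sup>2) ^ n * coeff (pade_numer (1 / of_nat p :: 'a::field_char_0) r) n \<in> \<int>"
proof -
  let ?\<nu> = "1 / of_nat p :: 'a"
  have "of_nat (p\<^sup>2) ^ n * fps_nth (pade_series ?\<nu> r) n =
      (\<Sum>j\<le>n. (of_nat (p\<^sup>2) ^ j * coeff (pade_denom ?\<nu> r) j) *
        (of_nat (p\<^sup>2) ^ (n - j) * (- ?\<nu> gchoose (n - j))))"
    unfolding pade_series_nth sum_distrib_left
  proof (rule sum.cong)
    fix j assume "j \<in> {..n}"
    then have "of_nat (p\<^sup>2) ^ n = (of_nat (p\<^sup>2) ^ j * of_nat (p\<^sup>2) ^ (n - j) :: 'a)"
      by (simp add: power_add[symmetric] del: of_nat_power)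
    then show "of_nat (p\<^sup>2) ^ n * (coeff (pade_denom ?\<nu> r) j * (- ?\<nu> gchoose (n - j))) =
       of_nat (p\<^sup>2) ^ j * coeff (pade_denom ?\<nu> r) j * (of_nat (p\<^sup>2) ^ (n - j) * (- ?\<nu> gchoose (n - j)))"
      by (simp del: of_nat_power)
  qed simp
  also have "\<dots> \<in> \<int>"
    by (rule Ints_sum, rule Ints_mult, rule pade_denom_in_Ints[OF assms],
        rule binomial_denominator_pade(2)[OF assms, unfolded binomial_denominator_def, rule_format])
  finally show ?thesis by (simp add: coeff_pade_numer)
qed

section \<open>Size of the Pade coefficients and of the remainder\<close>

lemma norm_gbinomial_le_1:
  fixes x :: "'a::{real_normed_field,field_char_0}"
  assumes "norm x \<le> 1"
  shows "norm (x gchoose n) \<le> 1"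
proof (induction n)
  case (Suc n)
  \<comment> \<open>Consecutive coefficients have the ratio (x - n)/(n + 1), of norm at most
    1.\<close>
  have "of_nat (Suc n) * (x gchoose Suc n) = (x - of_nat n) * (x gchoose n)"
    using gbinomial_mult_1[of x n] by (simp add: algebra_simps)
  then have "real (Suc n) * norm (x gchoose Suc n) = norm (x - of_nat n) * norm (x gchoose n)"
    by (metis norm_mult norm_of_nat)
  also have "\<dots> \<le> real (Suc n) * 1"
  proof (rule mult_mono)
    show "norm (x - of_nat n) \<le> real (Suc n)"
      using norm_triangle_ineq4[of x "of_nat n"] assms by simp
  qed (use Suc in auto)
  finally show ?case by (metis mult_le_cancel_left_pos of_nat_0_less_iff zero_less_Suc)
qed simp

text \<open>Vandermonde separates r, which contributes at most the binomial row sum 2^r, from x,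
  whose coefficients are bounded by 1.\<close>

lemma norm_gbinomial_add_le:
  fixes x :: "'a::{real_normed_field,field_char_0}"
  assumes "norm x \<le> 1" "j \<le> r"
  shows "norm (of_nat r + x gchoose j) \<le> 2 ^ r"
proof -
  have "norm (of_nat r + x gchoose j) \<le> (\<Sum>i=0..j. norm ((of_nat r gchoose i) * (x gchoose (j - i))))"
    unfolding gbinomial_Vandermonde[symmetric] by (rule norm_sum)
  also have "\<dots> \<le> (\<Sum>i=0..j. real (r choose i))"
  proof (rule sum_mono)
    fix i
    show "norm ((of_nat r gchoose i) * (x gchoose (j - i))) \<le> real (r choose i)"
      using norm_gbinomial_le_1[OF assms(1), of "j - i"]
      by (simp add: binomial_gbinomial[symmetric] norm_mult mult_left_le)
  qed
  also have "\<dots> \<le> (\<Sum>i\<le>r. real (r choose i))"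
    using assms by (intro sum_mono2) auto
  also have "\<dots> = 2 ^ r"
    unfolding of_nat_sum[symmetric] choose_row_sum by simp
  finally show ?thesis .
qed

lemma norm_coeff_pade_denom_le:
  fixes \<nu> :: "'a::{real_normed_field,field_char_0}"
  assumes "norm \<nu> \<le> 1"
  shows "norm (coeff (pade_denom \<nu> r) j) \<le> 8 ^ r"
proof (cases "j \<le> r")
  case True
  have "(2 * r - j) choose r \<le> 2 ^ (2 * r - j)"
    by (rule binomial_le_pow2)
  also have "\<dots> \<le> (2::nat) ^ (2 * r)" by (rule power_increasing) auto
  also have "\<dots> = 4 ^ r" by (simp add: power_mult)
  finally have "real ((2 * r - j) choose r) \<le> 4 ^ r"
    by (metis of_nat_le_iff of_nat_numeral of_nat_power)
  then have "norm (coeff (pade_denom \<nu> r) j) \<le> 4 ^ r * 2 ^ r"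
    using norm_gbinomial_add_le[OF assms True] True
    by (simp add: coeff_pade_denom norm_mult mult_mono)
  then show ?thesis by (simp add: power_mult_distrib[symmetric])
qed (simp add: coeff_pade_denom)

text \<open>Absorbs the number of summands into the exponential; this is how 16 arises from the
  coefficient bound 8^r.\<close>

lemma Suc_mult_8_pow_le: "real (Suc r) * 8 ^ r \<le> 16 ^ r"
proof -
  have "Suc r \<le> 2 ^ r" by (simp add: Suc_leI)
  then have "real (Suc r) \<le> 2 ^ r" by (metis of_nat_le_iff of_nat_numeral of_nat_power)
  then have "real (Suc r) * 8 ^ r \<le> 2 ^ r * 8 ^ r" by (rule mult_right_mono) simp
  then show ?thesis by (simp add: power_mult_distrib[symmetric])
qed

lemma norm_pade_series_le:
  fixes \<nu> :: "'a::{real_normed_field,field_char_0}"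
  assumes "norm \<nu> \<le> 1"
  shows "norm (fps_nth (pade_series \<nu> r) n) \<le> 16 ^ r"
proof -
  have "norm (fps_nth (pade_series \<nu> r) n) \<le>
     (\<Sum>j\<le>n. norm (coeff (pade_denom \<nu> r) j * (- \<nu> gchoose (n - j))))"
    unfolding pade_series_nth by (rule norm_sum)
  also have "\<dots> \<le> (\<Sum>j\<le>n. if j \<le> r then 8 ^ r else 0)"
  proof (rule sum_mono)
    fix j
    show "norm (coeff (pade_denom \<nu> r) j * (- \<nu> gchoose (n - j))) \<le> (if j \<le> r then 8 ^ r else 0)"
      using norm_coeff_pade_denom_le[OF assms, of r j] norm_gbinomial_le_1[of "- \<nu>" "n - j"] assms
        mult_mono[of "norm (coeff (pade_denom \<nu> r) j)" "8 ^ r" "norm (- \<nu> gchoose (n - j))" 1]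
      by (auto simp: norm_mult coeff_pade_denom)
  qed
  also have "\<dots> = (\<Sum>j\<in>{..n} \<inter> {..r}. 8 ^ r)"
    by (rule sum.mono_neutral_cong_right) auto
  also have "\<dots> = real (card ({..n} \<inter> {..r})) * 8 ^ r" by simp
  also have "\<dots> \<le> real (Suc r) * 8 ^ r"
  proof (intro mult_right_mono)
    show "real (card ({..n} \<inter> {..r})) \<le> real (Suc r)"
      using card_mono[of "{..r}" "{..n} \<inter> {..r}"] by simp
  qed simp
  finally show ?thesis using Suc_mult_8_pow_le[of r] by linarith
qed

lemma norm_pade_denom_le:
  fixes \<nu> :: "'a::{real_normed_field,field_char_0}"
  assumes "norm \<nu> \<le> 1" "norm w \<le> 1"
  shows "norm (poly (pade_denom \<nu> r) w) \<le> 16 ^ r"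
proof -
  have "norm (poly (pade_denom \<nu> r) w) = norm (\<Sum>j\<le>r. coeff (pade_denom \<nu> r) j * w ^ j)"
    by (simp add: pade_denom_def poly_sum poly_monom coeff_pade_denom[unfolded pade_denom_def])
  also have "\<dots> \<le> (\<Sum>j\<le>r. 8 ^ r)"
  proof (rule sum_norm_le)
    fix j
    show "norm (coeff (pade_denom \<nu> r) j * w ^ j) \<le> 8 ^ r"
      using norm_coeff_pade_denom_le[OF assms(1), of r j] power_le_one[OF _ assms(2), of j]
        mult_mono[of "norm (coeff (pade_denom \<nu> r) j)" "8 ^ r" "norm w ^ j" 1]
      by (simp add: norm_mult norm_power)
  qed
  also have "\<dots> \<le> 16 ^ r" using Suc_mult_8_pow_le[of r] by simp
  finally show ?thesis .
qed

text \<open>A geometric majorant of ratio 1/2 sums to twice its first term.\<close>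

lemma power_series_tail_le:
  fixes c :: "nat \<Rightarrow> 'a::{real_normed_field,banach}"
  assumes "(\<lambda>n. c n * w ^ n) sums S" "\<And>n. norm (c n) \<le> C" "norm w \<le> 1 / 2"
  shows "norm (S - (\<Sum>n<N. c n * w ^ n)) \<le> 2 * C * norm w ^ N"
proof -
  have "(\<lambda>n. c (n + N) * w ^ (n + N)) sums (S - (\<Sum>n<N. c n * w ^ n))"
    using sums_split_initial_segment[OF assms(1)] .
  then have S: "S - (\<Sum>n<N. c n * w ^ n) = (\<Sum>n. c (n + N) * w ^ (n + N))"
    by (simp add: sums_iff)
  have C: "C \<ge> 0" using assms(2)[of 0] norm_ge_zero order_trans by blast
  have bound: "norm (c (n + N) * w ^ (n + N)) \<le> (C * norm w ^ N) * (1 / 2) ^ n" for n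
  proof -
    have "norm (c (n + N) * w ^ (n + N)) = norm (c (n + N)) * (norm w ^ N * norm w ^ n)"
      by (simp add: norm_mult norm_power power_add mult_ac)
    also have "\<dots> \<le> C * (norm w ^ N * (1 / 2) ^ n)"
      using assms C by (intro mult_mono power_mono) auto
    finally show ?thesis by (simp add: mult_ac)
  qed
  have geo: "(\<lambda>n. (C * norm w ^ N) * (1 / 2) ^ n) sums ((C * norm w ^ N) * 2)"
    using sums_mult[OF geometric_sums[of "1 / 2 :: real"], of "C * norm w ^ N"] by simp
  have "norm (S - (\<Sum>n<N. c n * w ^ n)) \<le> (\<Sum>n. (C * norm w ^ N) * (1 / 2) ^ n)"
    unfolding S using bound geo by (intro norm_suminf_le) (auto simp: sums_iff)
  then show ?thesis using geo by (simp add: sums_iff mult_ac)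
qed

text \<open>Passes from the formal identity to functions: the Cauchy product of a polynomial with
  the absolutely convergent binomial series.\<close>

lemma pade_series_sums:
  fixes \<nu> w :: complex
  assumes "norm \<nu> \<le> 1" "norm w \<le> 1 / 2"
  shows "(\<lambda>n. fps_nth (pade_series \<nu> r) n * w ^ n) sums
     (poly (pade_denom \<nu> r) w * (1 + w) powr (- \<nu>))"
proof -
  define a where "a j = coeff (pade_denom \<nu> r) j * w ^ j" for j
  define b where "b n = (- \<nu> gchoose n) * w ^ n" for n
  have a: "a sums poly (pade_denom \<nu> r) w"
  proof -
    have "a sums (\<Sum>j\<le>r. a j)"
      by (rule sums_finite) (auto simp: a_def coeff_pade_denom)
    then show ?thesis
      by (simp add: a_def pade_denom_def poly_sum poly_monom coeff_pade_denom[unfolded pade_denom_def])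
  qed
  have b: "b sums (1 + w) powr (- \<nu>)"
    unfolding b_def by (rule gen_binomial_complex) (use assms in simp)
  have "summable (\<lambda>k. norm (a k))"
    by (rule summable_finite[of "{..r}"]) (auto simp: a_def coeff_pade_denom)
  moreover have "summable (\<lambda>k. norm (b k))"
  proof (rule summable_comparison_test')
    show "summable (\<lambda>n. (1 / 2 :: real) ^ n)" by (simp add: summable_geometric)
    show "norm (norm (b n)) \<le> (1 / 2) ^ n" if "n \<ge> 0" for n
    proof -
      have "norm (b n) \<le> 1 * (1 / 2) ^ n"
        unfolding b_def norm_mult norm_power using assms
        by (intro mult_mono power_mono norm_gbinomial_le_1) auto
      then show ?thesis by simp
    qed
  qed
  ultimately have "(\<lambda>k. \<Sum>i\<le>k. a i * b (k - i)) sums ((\<Sum>k. a k) * (\<Sum>k. b k))"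
    by (rule Cauchy_product_sums)
  moreover have "(\<Sum>i\<le>k. a i * b (k - i)) = fps_nth (pade_series \<nu> r) k * w ^ k" for k
    unfolding pade_series_nth sum_distrib_right
  proof (rule sum.cong)
    fix i assume "i \<in> {..k}"
    then have "w ^ k = w ^ i * w ^ (k - i)" by (simp add: power_add[symmetric])
    then show "a i * b (k - i) = coeff (pade_denom \<nu> r) i * (- \<nu> gchoose (k - i)) * w ^ k"
      by (simp add: a_def b_def)
  qed simp
  ultimately show ?thesis using a b by (simp add: sums_iff)
qed

text \<open>Coefficients r + 1 to 2r of the series vanish, so the numerator is the partial sum below
  2r + 1 and the error is a power series tail.\<close>

lemma pade_remainder_le:
  fixes \<nu> w :: complex
  assumes "norm \<nu> \<le> 1" "norm w \<le> 1 / 2"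
  shows "norm ((1 + w) powr (- \<nu>) * poly (pade_denom \<nu> r) w - poly (pade_numer \<nu> r) w)
     \<le> 2 * 16 ^ r * norm w ^ (2 * r + 1)"
proof -
  have "(\<Sum>n<2 * r + 1. fps_nth (pade_series \<nu> r) n * w ^ n) =
      (\<Sum>n\<le>r. fps_nth (pade_series \<nu> r) n * w ^ n)"
    by (rule sum.mono_neutral_right) (auto simp: pade_series_nth_eq_0)
  also have "\<dots> = poly (pade_numer \<nu> r) w"
    by (simp add: pade_numer_def poly_sum poly_monom)
  finally show ?thesis
    using power_series_tail_le[OF pade_series_sums[OF assms, of r] norm_pade_series_le[OF assms(1)] assms(2),
        of "2 * r + 1"]
    by (simp add: mult.commute)
qed

lemma norm_powr_minus_one_le:
  fixes \<nu> w :: complex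
  assumes "norm \<nu> \<le> 1" "norm w \<le> 1 / 2"
  shows "norm ((1 + w) powr (- \<nu>) - 1) \<le> 2 * norm w"
proof -
  have "(\<lambda>n. (- \<nu> gchoose n) * w ^ n) sums (1 + w) powr (- \<nu>)"
    by (rule gen_binomial_complex) (use assms in simp)
  from power_series_tail_le[OF this norm_gbinomial_le_1 assms(2), of 1] assms(1)
  show ?thesis by simp
qed

section \<open>The ring of integer combinations of 1 and the square root of \<open>-D\<close>\<close>

definition quad_ring :: "int \<Rightarrow> complex set" where
  "quad_ring D = {Complex (of_int u) (of_int v * sqrt (of_int D)) | u v. True}"

lemma quad_ringI: "Complex (of_int u) (of_int v * sqrt (of_int D)) \<in> quad_ring D"
  by (auto simp: quad_ring_def)

lemma quad_ringE:
  assumes "z \<in> quad_ring D"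
  obtains u v where "z = Complex (of_int u) (of_int v * sqrt (of_int D))"
  using assms by (auto simp: quad_ring_def)

lemma quad_mult_expand:
  assumes "D \<ge> 0"
  shows "Complex (of_int u) (of_int v * sqrt (of_int D)) * Complex (of_int u') (of_int v' * sqrt (of_int D))
     = Complex (of_int (u * u' - D * v * v')) (of_int (u * v' + v * u') * sqrt (of_int D))"
proof -
  have "sqrt (of_int D) * sqrt (of_int D) = (of_int D :: real)"
    using assms by simp
  then have "of_int v * sqrt (of_int D) * (of_int v' * sqrt (of_int D)) = (of_int (D * v * v') :: real)"
    by (simp add: mult_ac)
  then show ?thesis
    using assms by (simp add: complex_eq_iff algebra_simps)
qed

lemma quad_ring_of_int [intro]: "of_int n \<in> quad_ring D"
  using quad_ringI[of n 0 D] by (simp add: complex_of_real_def[symmetric] of_real_of_int_eq)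

lemma quad_ring_add [intro]: "x \<in> quad_ring D \<Longrightarrow> y \<in> quad_ring D \<Longrightarrow> x + y \<in> quad_ring D"
proof (elim quad_ringE)
  fix u v u' v'
  assume "x = Complex (of_int u) (of_int v * sqrt (of_int D))"
    and "y = Complex (of_int u') (of_int v' * sqrt (of_int D))"
  then show ?thesis
    using quad_ringI[of "u + u'" "v + v'" D] by (simp add: ring_distribs complex_add)
qed

lemma quad_ring_uminus [intro]: "x \<in> quad_ring D \<Longrightarrow> - x \<in> quad_ring D"
proof (elim quad_ringE)
  fix u v assume "x = Complex (of_int u) (of_int v * sqrt (of_int D))"
  then show ?thesis using quad_ringI[of "- u" "- v" D] by (simp add: complex_minus)
qed

lemma quad_ring_diff [intro]: "x \<in> quad_ring D \<Longrightarrow> y \<in> quad_ring D \<Longrightarrow> x - y \<in> quad_ring D"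
  using quad_ring_add[of x D "- y"] by auto

lemma quad_ring_cnj [intro]: "x \<in> quad_ring D \<Longrightarrow> cnj x \<in> quad_ring D"
proof (elim quad_ringE)
  fix u v assume "x = Complex (of_int u) (of_int v * sqrt (of_int D))"
  then show ?thesis using quad_ringI[of u "- v" D] by (simp add: complex_cnj)
qed

lemma quad_ring_mult [intro]:
  "D \<ge> 0 \<Longrightarrow> x \<in> quad_ring D \<Longrightarrow> y \<in> quad_ring D \<Longrightarrow> x * y \<in> quad_ring D"
  by (auto elim!: quad_ringE simp only: quad_mult_expand intro!: quad_ringI)

lemma quad_ring_power [intro]: "D \<ge> 0 \<Longrightarrow> x \<in> quad_ring D \<Longrightarrow> x ^ n \<in> quad_ring D"
  using quad_ring_of_int[of 1 D] by (induction n) auto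

lemma quad_ring_sum: "(\<And>i. i \<in> A \<Longrightarrow> f i \<in> quad_ring D) \<Longrightarrow> sum f A \<in> quad_ring D"
  using quad_ring_of_int[of 0 D] by (induction A rule: infinite_finite_induct) auto

lemma cmod_quad:
  assumes "D \<ge> 0"
  shows "(cmod (Complex (of_int u) (of_int v * sqrt (of_int D))))\<^sup>2 = of_int (u\<^sup>2 + D * v\<^sup>2)"
  using assms by (simp add: cmod_power2 power_mult_distrib mult.commute)

text \<open>The squared absolute value is the integer u^2 + D v^2. This discreteness supplies the
  lower bound in the final contradiction.\<close>

lemma quad_ring_norm_ge_1:
  assumes "D \<ge> 0" "z \<in> quad_ring D" "z \<noteq> 0"
  shows "cmod z \<ge> 1"
proof -
  obtain u v where z: "z = Complex (of_int u) (of_int v * sqrt (of_int D))"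
    using assms(2) by (rule quad_ringE)
  have "(cmod z)\<^sup>2 = of_int (u\<^sup>2 + D * v\<^sup>2)"
    unfolding z by (rule cmod_quad[OF assms(1)])
  moreover have "(cmod z)\<^sup>2 > 0" using assms(3) by simp
  ultimately have "u\<^sup>2 + D * v\<^sup>2 \<ge> 1" by (simp only: of_int_0_less_iff)
  then have "(cmod z)\<^sup>2 \<ge> 1\<^sup>2"
    using \<open>(cmod z)\<^sup>2 = _\<close> by (metis of_int_1_le_iff one_power2)
  then show ?thesis by (rule power2_le_imp_le) simp
qed

lemma finite_quad_ring_bounded:
  assumes "D > 0"
  shows "finite {z \<in> quad_ring D. (cmod z)\<^sup>2 \<le> R}"
proof (rule finite_subset)
  define N where "N = \<lfloor>R\<rfloor>"
  let ?f = "\<lambda>(u, v). Complex (of_int u) (of_int v * sqrt (of_int D))"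
  show "{z \<in> quad_ring D. (cmod z)\<^sup>2 \<le> R} \<subseteq> ?f ` ({-N..N} \<times> {-N..N})"
  proof
    fix z assume "z \<in> {z \<in> quad_ring D. (cmod z)\<^sup>2 \<le> R}"
    then obtain u v where z: "z = Complex (of_int u) (of_int v * sqrt (of_int D))" and "(cmod z)\<^sup>2 \<le> R"
      using quad_ringE by blast
    then have "of_int (u\<^sup>2 + D * v\<^sup>2) \<le> R"
      using cmod_quad[of D u v] assms by simp
    then have le: "u\<^sup>2 + D * v\<^sup>2 \<le> N"
      by (simp add: N_def le_floor_iff)
    have *: "\<bar>t\<bar> \<le> t\<^sup>2" for t :: int
      using self_le_power[of "\<bar>t\<bar>" 2] by (cases "t = 0") auto
    have "1 * v\<^sup>2 \<le> D * v\<^sup>2" using assms by (intro mult_right_mono) auto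
    then have "\<bar>u\<bar> \<le> N" "\<bar>v\<bar> \<le> N"
      using le *[of u] *[of v] zero_le_power2[of u] zero_le_power2[of v] by linarith+
    then show "z \<in> ?f ` ({-N..N} \<times> {-N..N})" using z by force
  qed
qed auto

section \<open>Thue's lemma and representation by p-th powers up to a bounded factor\<close>

lemma thue_small_solution:
  fixes k X :: int
  assumes "k > 0"
  obtains u v :: int where "(u, v) \<noteq> (0, 0)" "u\<^sup>2 \<le> k" "v\<^sup>2 \<le> k" "k dvd u - X * v"
proof -
  define s where "s = \<lfloor>sqrt (of_int k)\<rfloor>"
  have s0: "s \<ge> 0" using assms by (simp add: s_def)
  have "of_int s \<le> sqrt (of_int k)" unfolding s_def by simp
  then have "(of_int s)\<^sup>2 \<le> (of_int k :: real)"
    using s0 assms by (metis of_int_0_le_iff real_sqrt_ge_0_iff real_sqrt_le_iff real_sqrt_abs abs_of_nonneg)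
  then have sk: "s\<^sup>2 \<le> k" by (metis of_int_le_iff of_int_power)
  have "sqrt (of_int k) < of_int (s + 1)" unfolding s_def by linarith
  then have "of_int k < (of_int (s + 1) :: real)\<^sup>2"
    by (meson not_le real_le_rsqrt)
  then have ks: "k < (s + 1)\<^sup>2" by (metis of_int_less_iff of_int_power)
  define f where "f = (\<lambda>(u, v). (u - X * v) mod k)"
  \<comment> \<open>Pigeonhole: (s + 1)^2 > k pairs compete for k residues, and the difference of
    two colliding pairs is the solution.\<close>
  have "\<not> inj_on f ({0..s} \<times> {0..s})"
  proof
    assume "inj_on f ({0..s} \<times> {0..s})"
    moreover have "f ` ({0..s} \<times> {0..s}) \<subseteq> {0..<k}"
      using assms by (auto simp: f_def)
    ultimately have "card ({0..s} \<times> {0..s}) \<le> card {0..<k}"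
      by (rule card_inj_on_le) simp
    then have "nat (s + 1) * nat (s + 1) \<le> nat k"
      by (simp add: card_cartesian_product)
    then have "(s + 1) * (s + 1) \<le> k"
      using s0 assms by (simp add: nat_mult_distrib[symmetric])
    then show False using ks by (simp add: power2_eq_square)
  qed
  then obtain u v u' v' where
    uv: "(u, v) \<noteq> (u', v')" "f (u, v) = f (u', v')"
      "u \<in> {0..s}" "v \<in> {0..s}" "u' \<in> {0..s}" "v' \<in> {0..s}"
    unfolding inj_on_def by fast
  have small: "(x - y)\<^sup>2 \<le> k" if "x \<in> {0..s}" "y \<in> {0..s}" for x y
  proof -
    have "\<bar>x - y\<bar> \<le> \<bar>s\<bar>" using that by auto
    then have "(x - y)\<^sup>2 \<le> s\<^sup>2" by (simp add: abs_le_square_iff)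
    then show ?thesis using sk by linarith
  qed
  have "k dvd (u - X * v) - (u' - X * v')"
    using uv(2) by (simp add: f_def mod_eq_dvd_iff)
  then have "k dvd (u - u') - X * (v - v')" by (simp add: algebra_simps)
  moreover have "(u - u', v - v') \<noteq> (0, 0)" using uv(1) by auto
  ultimately show ?thesis
    using that small uv by blast
qed

text \<open>Since \<open>k\<^sup>p\<close> divides \<open>X\<^sup>2 + D\<close>, sending \<open>\<surd>(-D)\<close> to \<open>-X\<close> is a ring
  homomorphism onto the integers modulo \<open>k\<^sup>p\<close>. This replaces the factorisation of the ideal
  \<open>(X + \<surd>(-D))\<close>, and no coprimality is needed.\<close>

lemma quad_power_dvd:
  fixes X D k u v :: int
  assumes "D \<ge> 0" "k ^ p dvd X\<^sup>2 + D" "k dvd u - X * v" "n \<le> p"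
  shows "\<exists>U V. Complex (of_int u) (of_int v * sqrt (of_int D)) ^ n
      = Complex (of_int U) (of_int V * sqrt (of_int D)) \<and> k ^ n dvd U - X * V"
  using assms(4)
proof (induction n)
  case 0
  have "1 = Complex (of_int 1) (of_int 0 * sqrt (of_int D))" by (simp add: complex_eq_iff)
  then show ?case by (metis one_dvd power_0)
next
  case (Suc n)
  then obtain U V where UV: "Complex (of_int u) (of_int v * sqrt (of_int D)) ^ n
      = Complex (of_int U) (of_int V * sqrt (of_int D))" "k ^ n dvd U - X * V"
    by auto
  have "k ^ Suc n dvd (u - X * v) * (U - X * V)"
    unfolding power_Suc using UV(2) assms(3) by (rule mult_dvd_mono[rotated])
  \<comment> \<open>The map is multiplicative only modulo X^2 + D: the defect is (X^2 + D) v V,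
    which k^(n+1) divides because n + 1 \<le> p.\<close>
  moreover have "k ^ Suc n dvd (X\<^sup>2 + D) * (v * V)"
    using assms(2) Suc.prems by (meson dvd_mult2 dvd_trans le_imp_power_dvd)
  ultimately have "k ^ Suc n dvd (u - X * v) * (U - X * V) - (X\<^sup>2 + D) * (v * V)"
    by (rule dvd_diff)
  also have "(u - X * v) * (U - X * V) - (X\<^sup>2 + D) * (v * V)
     = (u * U - D * v * V) - X * (u * V + v * U)"
    by (simp add: algebra_simps power2_eq_square)
  finally show ?case
    unfolding power_Suc UV(1) quad_mult_expand[OF assms(1)] by blast
qed

text \<open>Thue's lemma provides \<xi> = u + v sqrt(-D) with |\<xi>|^2 \<le> (D + 1) k. Then k^p
  divides \<xi>^p \<open>cnj \<beta>\<close>, and \<gamma> is the quotient; multiplying by \<beta>,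
  whose norm is a k^p, gives the equation. Comparing absolute values, k^p cancels, so the bound on
  \<gamma> is independent of the solution.\<close>

lemma quad_power_representation:
  fixes X D a k :: int
  assumes D: "D > 0" and a: "a > 0" and k: "k > 0" and eq: "X\<^sup>2 + D = a * k ^ p"
  defines "\<beta> \<equiv> Complex (of_int X) (sqrt (of_int D))"
  obtains \<xi> \<gamma> where "\<xi> \<in> quad_ring D" "\<gamma> \<in> quad_ring D" "\<xi> \<noteq> 0" "\<gamma> \<noteq> 0"
    "(cmod \<gamma>)\<^sup>2 \<le> of_int (a * (D + 1) ^ p)" "of_int a * \<xi> ^ p = \<gamma> * \<beta>"
proof -
  obtain u v where uv: "(u, v) \<noteq> (0, 0)" "u\<^sup>2 \<le> k" "v\<^sup>2 \<le> k" "k dvd u - X * v"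
    using thue_small_solution[OF k] by blast
  define \<xi> where "\<xi> = Complex (of_int u) (of_int v * sqrt (of_int D))"
  have D0: "D \<ge> 0" using D by simp
  have "k ^ p dvd X\<^sup>2 + D" unfolding eq by simp
  from quad_power_dvd[OF D0 this uv(4) order_refl] obtain U V
    where UV: "\<xi> ^ p = Complex (of_int U) (of_int V * sqrt (of_int D))" "k ^ p dvd U - X * V"
    unfolding \<xi>_def by blast
  have cnj: "cnj \<beta> = Complex (of_int X) (of_int (- 1) * sqrt (of_int D))"
    by (simp add: \<beta>_def complex_cnj)
  have prod: "\<xi> ^ p * cnj \<beta> = Complex (of_int (U * X + D * V)) (of_int (V * X - U) * sqrt (of_int D))"
    unfolding UV(1) cnj quad_mult_expand[OF D0] by simp
  \<comment> \<open>Divisibility of the rational part of the product; for the coefficient of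
    sqrt(-D) it is already \<open>UV(2)\<close>.\<close>
  have "k ^ p dvd X * (U - X * V) + (X\<^sup>2 + D) * V"
    by (intro dvd_add[OF dvd_mult[OF UV(2)] dvd_mult2]) (simp add: eq)
  also have "X * (U - X * V) + (X\<^sup>2 + D) * V = U * X + D * V"
    by (simp add: algebra_simps power2_eq_square)
  finally obtain r where r: "U * X + D * V = k ^ p * r" by (rule dvdE)
  obtain s where "U - X * V = k ^ p * s" using UV(2) by (rule dvdE)
  then have s: "V * X - U = k ^ p * (- s)" by (simp add: algebra_simps)
  define \<gamma> where "\<gamma> = Complex (of_int r) (of_int (- s) * sqrt (of_int D))"
  have g: "\<xi> ^ p * cnj \<beta> = of_int (k ^ p) * \<gamma>"
    unfolding prod r s \<gamma>_def by (simp add: complex_eq_iff)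
  have bb: "\<beta> * cnj \<beta> = of_int (a * k ^ p)"
  proof -
    have "\<beta> * cnj \<beta> = of_real ((cmod \<beta>)\<^sup>2)" by (simp only: complex_norm_square)
    also have "(cmod \<beta>)\<^sup>2 = of_int (X\<^sup>2 + D)"
      using cmod_quad[OF D0, of X 1] by (simp add: \<beta>_def)
    finally show ?thesis by (simp only: eq of_real_of_int_eq)
  qed
  have "of_int (k ^ p) * (of_int a * \<xi> ^ p) = of_int (k ^ p) * (\<gamma> * \<beta>)"
    using g bb by (metis (no_types, opaque_lifting) mult.assoc mult.commute of_int_mult)
  moreover have kp: "of_int (k ^ p) \<noteq> (0 :: complex)" using k by simp
  ultimately have main: "of_int a * \<xi> ^ p = \<gamma> * \<beta>"
    using mult_left_cancel by blast
  have N: "(cmod \<xi>)\<^sup>2 = of_int (u\<^sup>2 + D * v\<^sup>2)"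
    unfolding \<xi>_def by (rule cmod_quad[OF D0])
  have "u\<^sup>2 + D * v\<^sup>2 > 0"
    using uv(1) D by (cases "u = 0") (auto intro: add_pos_nonneg)
  then have xi0: "\<xi> \<noteq> 0"
    using N by (metis less_irrefl norm_zero of_int_eq_0_iff zero_power2)
  then have gam0: "\<gamma> \<noteq> 0" using main a by auto
  have "D * v\<^sup>2 \<le> D * k" using uv(3) D by simp
  then have "u\<^sup>2 + D * v\<^sup>2 \<le> (D + 1) * k"
    using uv(2) by (simp add: algebra_simps)
  then have xile: "(cmod \<xi>)\<^sup>2 \<le> of_int ((D + 1) * k)"
    unfolding N by (simp only: of_int_le_iff)
  have "(of_int a)\<^sup>2 * ((cmod \<xi>)\<^sup>2) ^ p = (cmod \<gamma>)\<^sup>2 * (cmod \<beta>)\<^sup>2"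
  proof -
    have "of_int a * cmod \<xi> ^ p = cmod \<gamma> * cmod \<beta>"
      using arg_cong[OF main, of cmod] a by (simp add: norm_mult norm_power)
    then show ?thesis
      by (metis power_mult_distrib power_mult mult.commute)
  qed
  also have "(cmod \<beta>)\<^sup>2 = of_int (a * k ^ p)"
    using cmod_quad[OF D0, of X 1] eq by (simp add: \<beta>_def)
  finally have "(cmod \<gamma>)\<^sup>2 * of_int (a * k ^ p) = (of_int a)\<^sup>2 * ((cmod \<xi>)\<^sup>2) ^ p" by simp
  also have "\<dots> \<le> (of_int a)\<^sup>2 * of_int ((D + 1) * k) ^ p"
    using xile by (intro mult_left_mono power_mono) auto
  also have "\<dots> = of_int (a * (D + 1) ^ p) * of_int (a * k ^ p)"
    by (simp add: power2_eq_square power_mult_distrib)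
  finally have "(cmod \<gamma>)\<^sup>2 \<le> of_int (a * (D + 1) ^ p)"
    using a k by (subst (asm) mult_le_cancel_right_pos) auto
  moreover have "\<xi> \<in> quad_ring D" "\<gamma> \<in> quad_ring D"
    unfolding \<xi>_def \<gamma>_def by (rule quad_ringI)+
  ultimately show ?thesis using that main xi0 gam0 by blast
qed

section \<open>Finiteness of the solutions of \<open>X\<^sup>2 + D = a k\<^sup>p\<close>\<close>

lemma Ints_imp_quad_ring: "z \<in> \<int> \<Longrightarrow> z \<in> quad_ring D"
  by (auto elim: Ints_cases)

text \<open>Homogenising: with w the point of evaluation, \<beta> w =
  \<open>cnj \<beta> - \<beta>\<close>, so \<beta>^r w^j lies in the ring for j \<le> r, while q^r
  clears the coefficients.\<close>

lemma poly_cleared_in_quad_ring: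
  fixes P :: "complex poly"
  assumes D: "D \<ge> 0" and b: "\<beta> \<in> quad_ring D" "\<beta> \<noteq> 0"
    and P: "degree P \<le> r" "\<And>j. of_nat q ^ j * coeff P j \<in> \<int>"
  shows "of_nat q ^ r * \<beta> ^ r * poly P (cnj \<beta> / \<beta> - 1) \<in> quad_ring D"
proof -
  let ?w = "cnj \<beta> / \<beta> - 1"
  have bw: "\<beta> * ?w = cnj \<beta> - \<beta>" using b by (simp add: field_simps)
  have "poly P ?w = (\<Sum>j\<le>r. coeff P j * ?w ^ j)"
    unfolding poly_altdef using P(1)
    by (intro sum.mono_neutral_left) (auto simp: coeff_eq_0)
  then have "of_nat q ^ r * \<beta> ^ r * poly P ?w = (\<Sum>j\<le>r. of_nat q ^ r * \<beta> ^ r * (coeff P j * ?w ^ j))"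
    by (simp add: sum_distrib_left)
  also have "\<dots> = (\<Sum>j\<le>r. (of_nat q ^ j * coeff P j) * of_nat (q ^ (r - j)) * (\<beta> ^ (r - j) * (cnj \<beta> - \<beta>) ^ j))"
  proof (rule sum.cong)
    fix j assume "j \<in> {..r}"
    then have "of_nat q ^ r = (of_nat q ^ j * of_nat (q ^ (r - j)) :: complex)" "\<beta> ^ r = \<beta> ^ (r - j) * \<beta> ^ j"
      by (simp_all add: power_add[symmetric])
    then show "of_nat q ^ r * \<beta> ^ r * (coeff P j * ?w ^ j) =
        (of_nat q ^ j * coeff P j) * of_nat (q ^ (r - j)) * (\<beta> ^ (r - j) * (cnj \<beta> - \<beta>) ^ j)"
      unfolding bw[symmetric] power_mult_distrib by (simp only: mult_ac)
  qed simp
  also have "\<dots> \<in> quad_ring D"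
    using D b
    by (intro quad_ring_sum
        quad_ring_mult[OF D quad_ring_mult[OF D Ints_imp_quad_ring[OF P(2)] Ints_imp_quad_ring[OF Ints_of_nat]]]
        quad_ring_mult[OF D quad_ring_power quad_ring_power] quad_ring_diff quad_ring_cnj)
  finally show ?thesis .
qed

text \<open>The approximants give the form L = A \<open>cnj \<xi>\<^sub>0\<close> \<xi> - B
  \<open>\<xi>\<^sub>0\<close> \<open>cnj \<xi>\<close>. One of two consecutive forms is nonzero,
  and after clearing denominators its absolute value is at least 1; the right side of the conclusion
  bounds that value from above.\<close>

lemma linear_form_lower_bound:
  fixes p r :: nat and D :: int
  assumes p: "p \<ge> 2" and D: "D \<ge> 0"
    and ring: "\<beta>\<^sub>0 \<in> quad_ring D" "\<xi>\<^sub>0 \<in> quad_ring D" "\<xi> \<in> quad_ring D"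
    and nz: "\<beta>\<^sub>0 \<noteq> 0" "\<xi>\<^sub>0 \<noteq> 0" "\<xi> \<noteq> 0"
  defines "\<nu> \<equiv> 1 / of_nat p :: complex" and "w\<^sub>0 \<equiv> cnj \<beta>\<^sub>0 / \<beta>\<^sub>0 - 1"
  assumes w: "w\<^sub>0 \<noteq> 0" "cmod w\<^sub>0 \<le> 1 / 2" "cmod w \<le> 1 / 2"
    and eq: "(1 + w\<^sub>0) powr (- \<nu>) * cnj \<xi>\<^sub>0 * \<xi> = (1 + w) powr (- \<nu>) * \<xi>\<^sub>0 * cnj \<xi>"
  obtains r' where "r' = r \<or> r' = Suc r"
    "1 \<le> real (p\<^sup>2) ^ r' * cmod \<beta>\<^sub>0 ^ r' * (cmod \<xi>\<^sub>0 * cmod \<xi> *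
           (2 * 16 ^ r' * cmod w\<^sub>0 ^ (2 * r' + 1) + 16 ^ r' * (2 * cmod w)))"
proof -
  define A where "A r = poly (pade_numer \<nu> r) w\<^sub>0" for r
  define B where "B r = poly (pade_denom \<nu> r) w\<^sub>0" for r
  define L where "L r = A r * (cnj \<xi>\<^sub>0 * \<xi>) - B r * (\<xi>\<^sub>0 * cnj \<xi>)" for r
  have nu1: "cmod \<nu> \<le> 1" using p by (simp add: \<nu>_def norm_divide)
  have nu: "\<nu> \<notin> \<int>"
  proof
    assume "\<nu> \<in> \<int>"
    then obtain m where "\<nu> = of_int m" by (rule Ints_cases)
    then have "of_int (m * int p) = (of_int 1 :: complex)" using p by (simp add: \<nu>_def field_simps)
    then have "m * int p = 1" by (simp only: of_int_eq_iff)
    then show False using p by (auto simp: zmult_eq_1_iff)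
  qed
  \<comment> \<open>If both forms vanished, so would the determinant of the two approximants, which
    by \<open>pade_wronskian\<close> is a nonzero multiple of a power of
    \<open>w\<^sub>0\<close>.\<close>
  have "L r \<noteq> 0 \<or> L (Suc r) \<noteq> 0"
  proof (rule ccontr)
    assume "\<not> (L r \<noteq> 0 \<or> L (Suc r) \<noteq> 0)"
    then have e: "A r * (cnj \<xi>\<^sub>0 * \<xi>) = B r * (\<xi>\<^sub>0 * cnj \<xi>)"
      "A (Suc r) * (cnj \<xi>\<^sub>0 * \<xi>) = B (Suc r) * (\<xi>\<^sub>0 * cnj \<xi>)"
      by (auto simp: L_def)
    have "(A r * B (Suc r) - A (Suc r) * B r) * (cnj \<xi>\<^sub>0 * \<xi>) =
        (A r * (cnj \<xi>\<^sub>0 * \<xi>)) * B (Suc r) - (A (Suc r) * (cnj \<xi>\<^sub>0 * \<xi>)) * B r"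
      by (simp add: algebra_simps)
    also have "\<dots> = 0" unfolding e by simp
    finally have "A r * B (Suc r) - A (Suc r) * B r = 0" using nz by simp
    moreover obtain c where "c \<noteq> 0" and c: "pade_numer \<nu> r * pade_denom \<nu> (Suc r)
         - pade_numer \<nu> (Suc r) * pade_denom \<nu> r = monom c (2 * r + 1)"
      using pade_wronskian[OF nu] by blast
    have "A r * B (Suc r) - A (Suc r) * B r = c * w\<^sub>0 ^ (2 * r + 1)"
      using arg_cong[OF c, of "\<lambda>P. poly P w\<^sub>0"] unfolding A_def B_def by (simp only: poly_diff poly_mult poly_monom)
    ultimately show False using \<open>c \<noteq> 0\<close> w(1) by simp
  qed
  then obtain r' where r': "r' = r \<or> r' = Suc r" and L: "L r' \<noteq> 0" by blast
  let ?Q = "of_nat (p\<^sup>2) ^ r' * \<beta>\<^sub>0 ^ r' :: complex"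
  have p0: "p > 0" using p by simp
  have QA: "?Q * A r' \<in> quad_ring D"
    unfolding A_def w\<^sub>0_def \<nu>_def using D ring(1) nz(1) degree_pade_numer pade_numer_in_Ints[OF p0]
    by (rule poly_cleared_in_quad_ring)
  have QB: "?Q * B r' \<in> quad_ring D"
    unfolding B_def w\<^sub>0_def \<nu>_def using D ring(1) nz(1) degree_pade_denom pade_denom_in_Ints[OF p0]
    by (rule poly_cleared_in_quad_ring)
  have "(?Q * A r') * (cnj \<xi>\<^sub>0 * \<xi>) - (?Q * B r') * (\<xi>\<^sub>0 * cnj \<xi>) \<in> quad_ring D"
    by (rule quad_ring_diff[OF quad_ring_mult[OF D QA quad_ring_mult[OF D quad_ring_cnj[OF ring(2)] ring(3)]]
          quad_ring_mult[OF D QB quad_ring_mult[OF D ring(2) quad_ring_cnj[OF ring(3)]]]])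
  also have "(?Q * A r') * (cnj \<xi>\<^sub>0 * \<xi>) - (?Q * B r') * (\<xi>\<^sub>0 * cnj \<xi>) = ?Q * L r'"
    unfolding L_def by (simp only: right_diff_distrib mult.assoc)
  finally have "1 \<le> cmod (?Q * L r')"
    using D L nz(1) p by (intro quad_ring_norm_ge_1) auto
  also have "\<dots> = real (p\<^sup>2) ^ r' * cmod \<beta>\<^sub>0 ^ r' * cmod (L r')"
    by (simp add: norm_mult norm_power)
  finally have one: "1 \<le> real (p\<^sup>2) ^ r' * cmod \<beta>\<^sub>0 ^ r' * cmod (L r')" .
  let ?F = "(1 + w\<^sub>0) powr (- \<nu>)" and ?G = "(1 + w) powr (- \<nu>)"
  \<comment> \<open>By \<open>eq\<close> the form splits into the Pade remainder at
    \<open>w\<^sub>0\<close> and an error from replacing (1 + w)^(-\<nu>) by 1, which is small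
    because w is.\<close>
  have "L r' = - ((?F * B r' - A r') * (cnj \<xi>\<^sub>0 * \<xi>)) + B r' * (?G - 1) * (\<xi>\<^sub>0 * cnj \<xi>)"
  proof -
    have "?F * B r' * (cnj \<xi>\<^sub>0 * \<xi>) = B r' * (?F * cnj \<xi>\<^sub>0 * \<xi>)" by (simp only: mult_ac)
    also have "\<dots> = B r' * ?G * (\<xi>\<^sub>0 * cnj \<xi>)" unfolding eq by (simp only: mult_ac)
    finally show ?thesis unfolding L_def by (simp add: algebra_simps)
  qed
  then have "cmod (L r') \<le> cmod (- ((?F * B r' - A r') * (cnj \<xi>\<^sub>0 * \<xi>))) + cmod (B r' * (?G - 1) * (\<xi>\<^sub>0 * cnj \<xi>))"
    by (metis norm_triangle_ineq)
  also have "\<dots> = cmod (?F * B r' - A r') * (cmod \<xi>\<^sub>0 * cmod \<xi>) + cmod (B r') * cmod (?G - 1) * (cmod \<xi>\<^sub>0 * cmod \<xi>)"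
    by (simp add: norm_mult)
  also have "\<dots> \<le> (2 * 16 ^ r' * cmod w\<^sub>0 ^ (2 * r' + 1)) * (cmod \<xi>\<^sub>0 * cmod \<xi>)
       + 16 ^ r' * (2 * cmod w) * (cmod \<xi>\<^sub>0 * cmod \<xi>)"
    unfolding A_def B_def
    using pade_remainder_le[OF nu1 w(2), of r'] norm_powr_minus_one_le[OF nu1 w(3)]
      norm_pade_denom_le[OF nu1, of w\<^sub>0 r'] w(2)
    by (intro add_mono mult_mono mult_right_mono) auto
  finally have "cmod (L r') \<le> cmod \<xi>\<^sub>0 * cmod \<xi> *
           (2 * 16 ^ r' * cmod w\<^sub>0 ^ (2 * r' + 1) + 16 ^ r' * (2 * cmod w))"
    by (simp only: distrib_left mult_ac)
  then have "1 \<le> real (p\<^sup>2) ^ r' * cmod \<beta>\<^sub>0 ^ r' * (cmod \<xi>\<^sub>0 * cmod \<xi> *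
           (2 * 16 ^ r' * cmod w\<^sub>0 ^ (2 * r' + 1) + 16 ^ r' * (2 * cmod w)))"
    using order_trans[OF one mult_left_mono] by simp
  with r' that show ?thesis by blast
qed

text \<open>Here H and M are the sizes of the two solutions, and \<open>x\<^sub>0\<close>, x those
  of their roots, of order H^(1/5) and M^(1/5). Each summand is shown to be below 1/2 by comparing
  fifth powers; exponent 5 leaves about H^(3r') to spare, which beats the power of K.\<close>

lemma thue_size_contradiction:
  fixes K R H M x\<^sub>0 x :: real
  assumes K: "K \<ge> 2" "R\<^sup>2 \<le> K" and H: "H \<ge> K ^ 10"
    and M: "H ^ (2 * r) \<le> M" "M < H ^ (2 * r + 2)" and r: "5 \<le> r" "r' = r \<or> r' = Suc r"
    and x: "0 \<le> x\<^sub>0" "0 \<le> x" "x\<^sub>0 ^ 5 \<le> R * H" "x ^ 5 \<le> R * M"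
  shows "K ^ (r' + 1) * (x\<^sub>0 * x) * (1 / H ^ (r' + 1) + H ^ r' / M) < 1"
proof -
  have K1: "K \<ge> 1" using K by simp
  have H1: "H \<ge> 1" using H one_le_power[OF K1, of 10] by linarith
  have M0: "M > 0" using M(1) H1 zero_less_power[of H "2 * r"] by linarith
  have "(2::real) ^ 5 \<le> K ^ 5" using K by (intro power_mono) auto
  then have K32: "32 \<le> K ^ 5" by simp
  have "x\<^sub>0 ^ 5 * x ^ 5 \<le> (R * H) * (R * M)"
    using x by (intro mult_mono) (auto intro: order_trans[of 0 "x\<^sub>0 ^ 5"])
  also have "\<dots> = R\<^sup>2 * (H * M)" by (simp add: power2_eq_square mult_ac)
  also have "\<dots> \<le> K * (H * M)" using K H1 M0 by (intro mult_right_mono) auto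
  finally have xx: "x\<^sub>0 ^ 5 * x ^ 5 \<le> K * (H * M)" .
  \<comment> \<open>The exponent is 5r' + 5 from the fifth power, 5 from 2^5 \<le> K^5, and 1 from
    R^2 \<le> K.\<close>
  have base: "(2 * (K ^ (r' + 1) * (x\<^sub>0 * x))) ^ 5 \<le> K ^ (5 * r' + 11) * (H * M)"
  proof -
    have "(2 * (K ^ (r' + 1) * (x\<^sub>0 * x))) ^ 5 = 32 * K ^ (5 * r' + 5) * (x\<^sub>0 ^ 5 * x ^ 5)"
      by (simp add: power_mult_distrib power_mult[symmetric] power_add[symmetric] algebra_simps)
    also have "\<dots> \<le> K ^ 5 * K ^ (5 * r' + 5) * (K * (H * M))"
      using K1 x by (intro mult_mono[OF mult_right_mono[OF K32] xx]) auto
    also have "\<dots> = K ^ (5 * r' + 11) * (H * M)"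
      by (simp add: power_add power_numeral_reduce algebra_simps)
    finally show ?thesis .
  qed
  have KH: "K ^ m \<le> H ^ n" if "m \<le> 10 * n" for m n
  proof -
    have "K ^ m \<le> K ^ (10 * n)" using that K1 by (rule power_increasing)
    also have "\<dots> = (K ^ 10) ^ n" by (simp add: power_mult)
    also have "\<dots> \<le> H ^ n" using H K1 by (intro power_mono) auto
    finally show ?thesis .
  qed
  have "(2 * (K ^ (r' + 1) * (x\<^sub>0 * x))) ^ 5 < (H ^ (r' + 1)) ^ 5"
  proof -
    have "K ^ (5 * r' + 11) * (H * M) < K ^ (5 * r' + 11) * (H * H ^ (2 * r' + 2))"
    proof -
      have "M < H ^ (2 * r' + 2)"
        by (rule less_le_trans[OF M(2) power_increasing]) (use H1 r(2) in auto)
      then show ?thesis using K1 H1 by (intro mult_strict_left_mono) auto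
    qed
    \<comment> \<open>The spare exponent: 5(r' + 1) - (2r' + 3) = 3r' + 2.\<close>
    also have "\<dots> \<le> H ^ (3 * r' + 2) * (H * H ^ (2 * r' + 2))"
      using H1 by (intro mult_right_mono KH) auto
    also have "\<dots> = (H ^ (r' + 1)) ^ 5"
    proof -
      have "(r' + 1) * 5 = (3 * r' + 2) + Suc (2 * r' + 2)" by simp
      then show ?thesis unfolding power_mult[symmetric] by (simp only: power_add power_Suc)
    qed
    finally show ?thesis using base by linarith
  qed
  then have 1: "2 * (K ^ (r' + 1) * (x\<^sub>0 * x)) < H ^ (r' + 1)"
    by (rule power_less_imp_less_base) (use H1 in simp)
  have "(2 * (K ^ (r' + 1) * (x\<^sub>0 * x)) * H ^ r') ^ 5 < M ^ 5"
  proof -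
    have r5: "5 \<le> r'" "r' \<le> r + 1" using r by auto
    have "(2 * (K ^ (r' + 1) * (x\<^sub>0 * x)) * H ^ r') ^ 5 \<le> K ^ (5 * r' + 11) * (H * M) * H ^ (5 * r')"
      using base H1 by (subst power_mult_distrib) (auto simp: power_mult[symmetric] mult.commute intro: mult_right_mono)
    \<comment> \<open>This is where r \<ge> 5 enters: 5r' + 11 < 10(3r' - 9) holds exactly from r' =
      5 on. The 9 comes from M^4 \<ge> H^(8r) with r possibly equal to r' - 1.\<close>
    also have "\<dots> < H ^ (3 * r' - 9) * (H * M) * H ^ (5 * r')"
    proof -
      have "K ^ (5 * r' + 11) < K ^ (10 * (3 * r' - 9))"
        using K r5 by (intro power_strict_increasing) auto
      also have "\<dots> \<le> H ^ (3 * r' - 9)" by (rule KH) simp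
      finally show ?thesis using H1 M0 by (intro mult_strict_right_mono) auto
    qed
    also have "\<dots> = H ^ (8 * r' - 8) * M"
    proof -
      have "8 * r' - 8 = (3 * r' - 9) + 1 + 5 * r'" using r5 by simp
      then show ?thesis by (simp only: power_add power_one_right mult_ac)
    qed
    also have "\<dots> \<le> (H ^ (2 * r)) ^ 4 * M"
      unfolding power_mult[symmetric] using H1 M0 r5 by (intro mult_right_mono power_increasing) auto
    also have "\<dots> \<le> M ^ 4 * M"
      using M(1) M0 H1 by (intro mult_right_mono power_mono) auto
    also have "\<dots> = M ^ 5" by (simp add: power_numeral_reduce)
    finally show ?thesis .
  qed
  then have 2: "2 * (K ^ (r' + 1) * (x\<^sub>0 * x)) * H ^ r' < M"
    by (rule power_less_imp_less_base) (use M0 in simp)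
  have "K ^ (r' + 1) * (x\<^sub>0 * x) / H ^ (r' + 1) < 1 / 2"
    using 1 H1 by (subst pos_divide_less_eq) auto
  moreover have "K ^ (r' + 1) * (x\<^sub>0 * x) * H ^ r' / M < 1 / 2"
    using 2 M0 by (subst pos_divide_less_eq) auto
  ultimately show ?thesis
    unfolding distrib_left times_divide_eq_right mult_1_right by linarith
qed

theorem finite_solutions_square_plus_eq_power:
  fixes D a :: int and p :: nat
  assumes p: "p \<ge> 5" and D: "D > 0" and a: "a > 0"
  shows "finite {X :: int. \<exists>k>0. X\<^sup>2 + D = a * k ^ p}" (is "finite ?S")
proof (rule ccontr)
  assume inf: "infinite ?S"
  have D0: "D \<ge> 0" using D by simp
  define \<beta> where "\<beta> X = Complex (of_int X) (sqrt (of_int D))" for X :: int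
  define w where "w X = cnj (\<beta> X) / \<beta> X - 1" for X
  define \<nu> :: complex where "\<nu> = 1 / of_nat p"
  define \<Gamma> where "\<Gamma> = (of_int (a * (D + 1) ^ p) :: real)"
  define T where "T = 2 * sqrt (of_int D)"
  define rep where "rep X z \<longleftrightarrow> fst z \<in> quad_ring D \<and> snd z \<in> quad_ring D \<and> fst z \<noteq> 0 \<and> snd z \<noteq> 0 \<and>
      (cmod (snd z))\<^sup>2 \<le> \<Gamma> \<and> of_int a * fst z ^ p = snd z * \<beta> X" for X z
  have "\<forall>X\<in>?S. \<exists>z. rep X z"
  proof
    fix X assume "X \<in> ?S"
    then obtain k where "k > 0" "X\<^sup>2 + D = a * k ^ p" by blast
    from quad_power_representation[OF D a this] obtain x g where
      "x \<in> quad_ring D" "g \<in> quad_ring D" "x \<noteq> 0" "g \<noteq> 0"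
      "(cmod g)\<^sup>2 \<le> of_int (a * (D + 1) ^ p)"
      "of_int a * x ^ p = g * Complex (of_int X) (sqrt (of_int D))" .
    then have "rep X (x, g)" by (simp add: rep_def \<Gamma>_def \<beta>_def)
    then show "\<exists>z. rep X z" ..
  qed
  then obtain f where f: "\<forall>X\<in>?S. rep X (f X)" by (rule bchoice[THEN exE])
  define \<xi> where "\<xi> X = fst (f X)" for X
  define \<gamma> where "\<gamma> X = snd (f X)" for X
  have rep: "\<xi> X \<in> quad_ring D" "\<gamma> X \<in> quad_ring D" "\<xi> X \<noteq> 0" "\<gamma> X \<noteq> 0"
      "(cmod (\<gamma> X))\<^sup>2 \<le> \<Gamma>" "of_int a * \<xi> X ^ p = \<gamma> X * \<beta> X" if "X \<in> ?S" for X
    using bspec[OF f that] by (simp_all add: rep_def \<xi>_def \<gamma>_def)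
  have b0: "\<beta> X \<noteq> 0" for X using D by (simp add: \<beta>_def complex_eq_iff)
  have b_ring: "\<beta> X \<in> quad_ring D" for X
    using quad_ringI[of X 1 D] by (simp add: \<beta>_def)
  have w1: "1 + w X = cnj (\<beta> X) / \<beta> X" for X by (simp add: w_def)
  have cw: "cmod (w X) = T / cmod (\<beta> X)" for X
  proof -
    have "w X = (cnj (\<beta> X) - \<beta> X) / \<beta> X" using b0[of X] by (simp add: w_def field_simps)
    moreover have "cnj (\<beta> X) - \<beta> X = Complex 0 (- T)" by (simp add: \<beta>_def T_def complex_eq_iff)
    moreover have "cmod (Complex 0 (- T)) = T" using D by (simp add: cmod_def T_def real_sqrt_mult)
    ultimately show ?thesis by (simp add: norm_divide)
  qed
  \<comment> \<open>A p-th root of \<open>cnj (\<gamma> X) / \<gamma> X\<close>. Equality of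
    \<kappa> at two solutions is precisely the relation required by
    \<open>linear_form_lower_bound\<close>.\<close>
  define \<kappa> where "\<kappa> X = (1 + w X) powr (- \<nu>) * cnj (\<xi> X) / \<xi> X" for X
  have kappa: "\<kappa> X ^ p = cnj (\<gamma> X) / \<gamma> X" if X: "X \<in> ?S" for X
  proof -
    have "((1 + w X) powr (- \<nu>)) ^ p = (1 + w X) powr (- 1)"
      using p b0[of X] by (simp add: w1 powr_def exp_of_nat_mult[symmetric] \<nu>_def)
    also have "\<dots> = \<beta> X / cnj (\<beta> X)"
      using b0[of X] by (simp add: w1 powr_minus)
    finally have F: "((1 + w X) powr (- \<nu>)) ^ p = \<beta> X / cnj (\<beta> X)" .
    have "of_int a * cnj (\<xi> X) ^ p = cnj (\<gamma> X) * cnj (\<beta> X)"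
      using arg_cong[OF rep(6)[OF X], of cnj] by simp
    then have cx: "cnj (\<xi> X) ^ p = cnj (\<gamma> X) * cnj (\<beta> X) / of_int a"
      using a by (simp add: field_simps)
    have x: "\<xi> X ^ p = \<gamma> X * \<beta> X / of_int a"
      using rep(6)[OF X] a by (simp add: field_simps)
    show ?thesis
      unfolding \<kappa>_def power_divide power_mult_distrib F cx x
      using b0[of X] a rep(4)[OF X] by (simp add: field_simps)
  qed
  \<comment> \<open>There are finitely many \<gamma>, and each leaves at most p values for \<kappa>;
    pigeonholing on the pair also fixes the root of unity.\<close>
  have "finite ((\<lambda>X. (\<gamma> X, \<kappa> X)) ` ?S)"
  proof (rule finite_subset)
    let ?G = "{z \<in> quad_ring D. (cmod z)\<^sup>2 \<le> \<Gamma>}"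
    show "(\<lambda>X. (\<gamma> X, \<kappa> X)) ` ?S \<subseteq> (SIGMA g:?G. {z. z ^ p = cnj g / g})"
    proof (rule image_subsetI)
      fix X assume X: "X \<in> ?S"
      show "(\<gamma> X, \<kappa> X) \<in> (SIGMA g:?G. {z. z ^ p = cnj g / g})"
        using rep(2,5)[OF X] kappa[OF X] by blast
    qed
    show "finite (SIGMA g:?G. {z. z ^ p = cnj g / g})"
      using finite_quad_ring_bounded[OF D] p by (intro finite_SigmaI finite_nth_roots) auto
  qed
  from pigeonhole_infinite[OF inf this] obtain X\<^sub>1 where
    "infinite {X \<in> ?S. (\<gamma> X, \<kappa> X) = (\<gamma> X\<^sub>1, \<kappa> X\<^sub>1)}" by blast
  then have inf': "infinite {X \<in> ?S. \<kappa> X = \<kappa> X\<^sub>1}"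
    by (rule infinite_super[rotated]) auto
  have large: "\<exists>X\<in>?S. \<kappa> X = \<kappa> X\<^sub>1 \<and> cmod (\<beta> X) \<ge> N" for N
  proof -
    let ?I = "{- \<lceil>N\<rceil>..\<lceil>N\<rceil>}"
    obtain X where X: "X \<in> ?S" "\<kappa> X = \<kappa> X\<^sub>1" "X \<notin> ?I"
      using inf' finite_subset[of "{X \<in> ?S. \<kappa> X = \<kappa> X\<^sub>1}" ?I] by blast
    then have "N \<le> \<bar>of_int X\<bar>" by (auto simp: not_le) linarith+
    also have "\<dots> \<le> cmod (\<beta> X)" using abs_Re_le_cmod[of "\<beta> X"] by (simp add: \<beta>_def)
    finally show ?thesis using X by blast
  qed
  have G1: "\<Gamma> \<ge> 1"
  proof -
    have "a * (D + 1) ^ p > 0" using a D by simp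
    then have "a * (D + 1) ^ p \<ge> 1" by linarith
    then show ?thesis unfolding \<Gamma>_def by linarith
  qed
  have T1: "T \<ge> 1"
  proof -
    have "sqrt (of_int D) \<ge> 1" using D by simp
    then show ?thesis unfolding T_def by linarith
  qed
  \<comment> \<open>As |\<xi>| \<ge> 1, exponent p may be lowered to 5; as |\<gamma>| \<ge> 1, the
    bound on |\<gamma>|^2 also bounds |\<gamma>|.\<close>
  have xi5: "cmod (\<xi> X) ^ 5 \<le> \<Gamma> * cmod (\<beta> X)" if X: "X \<in> ?S" for X
  proof -
    have "cmod (\<xi> X) \<ge> 1" using quad_ring_norm_ge_1[OF D0] rep X by blast
    then have "cmod (\<xi> X) ^ 5 \<le> cmod (\<xi> X) ^ p" using p by (intro power_increasing) auto
    also have "\<dots> \<le> of_int a * cmod (\<xi> X) ^ p"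
      using a by (simp add: mult_le_cancel_right1)
    also have "\<dots> = cmod (\<gamma> X) * cmod (\<beta> X)"
      using arg_cong[OF rep(6)[OF X], of cmod] a by (simp add: norm_mult norm_power)
    also have "\<dots> \<le> \<Gamma> * cmod (\<beta> X)"
    proof (rule mult_right_mono)
      have "cmod (\<gamma> X) \<ge> 1" using quad_ring_norm_ge_1[OF D0] rep X by blast
      then have "cmod (\<gamma> X) \<le> (cmod (\<gamma> X))\<^sup>2" using self_le_power[of "cmod (\<gamma> X)" 2] by simp
      then show "cmod (\<gamma> X) \<le> \<Gamma>" using rep(5)[OF X] by linarith
    qed simp
    finally show ?thesis .
  qed
  \<comment> \<open>The first entry serves R^2 \<le> K with R = \<Gamma>; the second makes K^(r'+1)
    absorb 2 (16 p^2)^r' T^(2r'+1).\<close>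
  define K where "K = max (\<Gamma>\<^sup>2) (32 * real (p\<^sup>2) * T\<^sup>2)"
  have K2: "K \<ge> 2"
  proof -
    have "32 * 1 * 1 \<le> 32 * real (p\<^sup>2) * T\<^sup>2"
      using p T1 by (intro mult_mono one_le_power) auto
    then show ?thesis unfolding K_def by linarith
  qed
  obtain X\<^sub>0 where X0: "X\<^sub>0 \<in> ?S" "\<kappa> X\<^sub>0 = \<kappa> X\<^sub>1" "cmod (\<beta> X\<^sub>0) \<ge> max (K ^ 10) (2 * T)"
    using large by blast
  define H where "H = cmod (\<beta> X\<^sub>0)"
  have H: "H \<ge> K ^ 10" "H \<ge> 2 * T" using X0 by (auto simp: H_def)
  have H2: "H \<ge> 2" using H T1 by linarith
  \<comment> \<open>The second solution is chosen after the first; size at least H^10 forces r \<ge>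
    5 below, and 2T keeps w within radius 1/2.\<close>
  obtain X where X: "X \<in> ?S" "\<kappa> X = \<kappa> X\<^sub>1" "cmod (\<beta> X) \<ge> max (H ^ 10) (2 * T)"
    using large by blast
  define M where "M = cmod (\<beta> X)"
  have M: "M \<ge> H ^ 10" "M \<ge> 2 * T" using X by (auto simp: M_def)
  \<comment> \<open>The degree r is chosen so that both error terms are small: r is the largest with
    H^(2r) \<le> M.\<close>
  obtain r where r: "H ^ (2 * r) \<le> M" "M < H ^ (2 * r + 2)" "5 \<le> r"
  proof -
    define P where "P n \<longleftrightarrow> M < (H\<^sup>2) ^ n" for n
    have HH: "H\<^sup>2 > 1" using H2 by (simp add: power2_eq_square less_1_mult)
    then obtain n where "P n" using real_arch_pow[of "H\<^sup>2" M] by (auto simp: P_def)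
    moreover have n5: "\<not> P n" if "n \<le> 5" for n
    proof -
      have "(H\<^sup>2) ^ n \<le> (H\<^sup>2) ^ 5" using that HH by (intro power_increasing) auto
      also have "\<dots> = H ^ 10" by (simp add: power_mult[symmetric])
      finally show ?thesis using M by (simp add: P_def)
    qed
    ultimately obtain m where m: "m < n" "\<not> P m" "P (Suc m)"
      using ex_least_nat_less[of P n] by auto
    then have "5 \<le> m" using n5[of "Suc m"] by (meson not_less_eq_eq)
    moreover have "H ^ (2 * m) \<le> M" using m(2) unfolding P_def power_mult by simp
    moreover have "M < H ^ (2 * m + 2)"
      using m(3) unfolding P_def power_mult[symmetric] by simp
    ultimately show ?thesis using that by blast
  qed
  have whalf: "cmod (w X\<^sub>0) \<le> 1 / 2" "cmod (w X) \<le> 1 / 2"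
    using H M H2 T1 b0[of X] unfolding cw by (auto simp: H_def[symmetric] M_def[symmetric] divide_le_eq)
  have w0: "w X\<^sub>0 \<noteq> 0"
    using cw[of X\<^sub>0] T1 b0[of X\<^sub>0] by auto
  have "(1 + w X\<^sub>0) powr (- \<nu>) * cnj (\<xi> X\<^sub>0) / \<xi> X\<^sub>0 = (1 + w X) powr (- \<nu>) * cnj (\<xi> X) / \<xi> X"
    using X0(2) X(2) by (simp add: \<kappa>_def)
  then have "(1 + w X\<^sub>0) powr (- \<nu>) * cnj (\<xi> X\<^sub>0) * \<xi> X = (1 + w X) powr (- \<nu>) * \<xi> X\<^sub>0 * cnj (\<xi> X)"
    using rep(3)[OF X0(1)] rep(3)[OF X(1)] by (simp add: field_simps)
  then obtain r' where r': "r' = r \<or> r' = Suc r" and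
    le: "1 \<le> real (p\<^sup>2) ^ r' * H ^ r' * (cmod (\<xi> X\<^sub>0) * cmod (\<xi> X) *
           (2 * 16 ^ r' * cmod (w X\<^sub>0) ^ (2 * r' + 1) + 16 ^ r' * (2 * cmod (w X))))"
    unfolding H_def
    using linear_form_lower_bound[of p D "\<beta> X\<^sub>0" "\<xi> X\<^sub>0" "\<xi> X" "w X" r] p D0 b_ring b0
      rep(1,3)[OF X0(1)] rep(1,3)[OF X(1)] whalf w0 unfolding w_def[of X\<^sub>0] \<nu>_def by auto
  let ?x = "cmod (\<xi> X\<^sub>0) * cmod (\<xi> X)"
  have H0: "H > 0" and M0: "M > 0" using H2 M T1 by linarith+
  have "real (p\<^sup>2) ^ r' * H ^ r' * (?x * (2 * 16 ^ r' * (T / H) ^ (2 * r' + 1) + 16 ^ r' * (2 * (T / M))))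
     \<le> K ^ (r' + 1) * ?x * (1 / H ^ (r' + 1) + H ^ r' / M)"
  proof -
    let ?c = "2 * (16 * real (p\<^sup>2)) ^ r'"
    have "real (p\<^sup>2) ^ r' * H ^ r' * (?x * (2 * 16 ^ r' * (T / H) ^ (2 * r' + 1) + 16 ^ r' * (2 * (T / M))))
      = ?x * (?c * T ^ (2 * r' + 1) * (H ^ r' / H ^ (2 * r' + 1)) + ?c * T * (H ^ r' / M))"
      by (simp add: power_divide power_mult_distrib algebra_simps)
    also have "H ^ r' / H ^ (2 * r' + 1) = 1 / H ^ (r' + 1)"
    proof -
      have "H ^ (2 * r' + 1) = H ^ r' * H ^ (r' + 1)" by (simp add: power_add[symmetric] mult_2)
      then show ?thesis using H0 by simp
    qed
    also have "?x * (?c * T ^ (2 * r' + 1) * (1 / H ^ (r' + 1)) + ?c * T * (H ^ r' / M))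
      \<le> ?x * (K ^ (r' + 1) * (1 / H ^ (r' + 1)) + K ^ (r' + 1) * (H ^ r' / M))"
    proof -
      have c: "?c \<le> (32 * real (p\<^sup>2)) ^ (r' + 1)"
      proof -
        have "?c \<le> 2 ^ (r' + 1) * (16 * real (p\<^sup>2)) ^ (r' + 1)"
        proof (intro mult_mono power_increasing)
          have "1 * 1 \<le> 16 * real (p\<^sup>2)" using p by (intro mult_mono) auto
          then show "1 \<le> 16 * real (p\<^sup>2)" by simp
        qed auto
        also have "\<dots> = (32 * real (p\<^sup>2)) ^ (r' + 1)"
          unfolding power_mult_distrib[symmetric] by simp
        finally show ?thesis .
      qed
      have bound: "?c * T ^ m \<le> K ^ (r' + 1)" if "m \<le> 2 * (r' + 1)" for m
      proof -
        have "?c * T ^ m \<le> (32 * real (p\<^sup>2)) ^ (r' + 1) * T ^ (2 * (r' + 1))"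
          using c T1 that by (intro mult_mono power_increasing) auto
        also have "\<dots> = (32 * real (p\<^sup>2) * T\<^sup>2) ^ (r' + 1)"
          by (simp only: power_mult_distrib power_mult)
        also have "\<dots> \<le> K ^ (r' + 1)" unfolding K_def using T1 by (intro power_mono) auto
        finally show ?thesis .
      qed
      have "?c * T \<le> K ^ (r' + 1)" using bound[of 1] by simp
      then show ?thesis
        using bound[of "2 * r' + 1"] H0 M0 by (intro mult_left_mono add_mono mult_right_mono) auto
    qed
    also have "\<dots> = K ^ (r' + 1) * ?x * (1 / H ^ (r' + 1) + H ^ r' / M)"
      by (simp add: algebra_simps)
    finally show ?thesis .
  qed
  moreover have "K ^ (r' + 1) * ?x * (1 / H ^ (r' + 1) + H ^ r' / M) < 1"
    using thue_size_contradiction[of K \<Gamma> H r M r' "cmod (\<xi> X\<^sub>0)" "cmod (\<xi> X)"] K2 H r r'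
      xi5[OF X0(1)] xi5[OF X(1)] by (simp add: H_def M_def K_def)
  ultimately show False
    using le unfolding cw H_def[symmetric] M_def[symmetric] by linarith
qed

section \<open>Bounds for the alternating sums\<close>

lemma exp_le_quadratic:
  fixes z :: real
  assumes "z \<le> 1"
  shows "exp z \<le> 1 + z + z\<^sup>2"
proof (cases "z \<ge> 0")
  case True
  then show ?thesis using exp_bound assms by blast
next
  case False
  define y where "y = - z"
  have y: "y \<ge> 0" using False by (simp add: y_def)
  \<comment> \<open>For negative z the claim is 1/exp y \<le> 1 - y + y^2; the Taylor polynomial
    below exp y already makes the product at least 1.\<close>
  have "1 \<le> (1 - y + y\<^sup>2) * (1 + y + y\<^sup>2 / 2)"
  proof -
    have "(1 - y + y\<^sup>2) * (1 + y + y\<^sup>2 / 2) = 1 + y\<^sup>2 / 2 + y ^ 3 / 2 + y ^ 4 / 2"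
      by (simp add: field_simps power2_eq_square power3_eq_cube power4_eq_xxxx)
    then show ?thesis using y by simp
  qed
  also have "\<dots> \<le> (1 - y + y\<^sup>2) * exp y"
  proof (rule mult_left_mono)
    show "1 + y + y\<^sup>2 / 2 \<le> exp y" using exp_lower_Taylor_quadratic[OF y] .
    have "0 \<le> (1 - y)\<^sup>2 + y" using y by simp
    also have "\<dots> = 1 - y + y\<^sup>2" by (simp add: power2_eq_square algebra_simps)
    finally show "0 \<le> 1 - y + y\<^sup>2" .
  qed
  finally have "1 / exp y \<le> 1 - y + y\<^sup>2" by (simp add: divide_le_eq)
  then show ?thesis by (simp add: y_def exp_minus field_simps)
qed

text \<open>Combines ln(1 + u) \<ge> v = u - 2u^2 with the quadratic bound for exp. The constant 11
  covers 2\<tau> \<le> 4 from the logarithm and 4 (5/4)^2 = 25/4 from (\<tau> v)^2.\<close>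

lemma powr_minus_le_quadratic:
  fixes u \<tau> :: real
  assumes u: "\<bar>u\<bar> \<le> 1 / 8" and \<tau>: "0 \<le> \<tau>" "\<tau> \<le> 2"
  shows "(1 + u) powr (- \<tau>) \<le> 1 - \<tau> * u + 11 * u\<^sup>2"
proof -
  define v where "v = u - 2 * u\<^sup>2"
  have u2: "u\<^sup>2 \<le> \<bar>u\<bar> / 8"
  proof -
    have "\<bar>u\<bar> * \<bar>u\<bar> \<le> \<bar>u\<bar> * (1 / 8)" using u by (intro mult_left_mono) auto
    then show ?thesis by (simp add: power2_eq_square)
  qed
  have v: "\<bar>v\<bar> \<le> 5 / 4 * \<bar>u\<bar>"
    unfolding v_def abs_le_iff
    using u2 zero_le_power2[of u] abs_ge_self[of u] abs_ge_minus_self[of u] by (intro conjI; linarith)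
  have "\<bar>ln (1 + u) - u\<bar> \<le> 2 * u\<^sup>2"
    using u by (intro abs_ln_one_plus_x_minus_x_bound) auto
  then have ln: "v \<le> ln (1 + u)" by (simp add: v_def)
  have "(1 + u) powr (- \<tau>) = exp (- \<tau> * ln (1 + u))" using u by (simp add: powr_def)
  also have "\<dots> \<le> exp (- \<tau> * v)" using ln \<tau> by (simp add: mult_left_mono)
  also have "\<dots> \<le> 1 + (- \<tau> * v) + (- \<tau> * v)\<^sup>2"
  proof (rule exp_le_quadratic)
    have "- \<tau> * v \<le> \<tau> * \<bar>v\<bar>" using \<tau> mult_left_mono[of "- v" "\<bar>v\<bar>" \<tau>] by simp
    also have "\<dots> \<le> 2 * (5 / 4 * (1 / 8))" using \<tau> v u by (intro mult_mono) auto
    finally show "- \<tau> * v \<le> 1" by simp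
  qed
  also have "(- \<tau> * v)\<^sup>2 \<le> 4 * (25 / 16 * u\<^sup>2)"
  proof -
    have "\<bar>v\<bar>\<^sup>2 \<le> (5 / 4 * \<bar>u\<bar>)\<^sup>2" using v by (intro power_mono) auto
    then have "v\<^sup>2 \<le> 25 / 16 * u\<^sup>2" by (simp add: power_mult_distrib power_divide)
    moreover have "\<tau>\<^sup>2 \<le> 2\<^sup>2" using \<tau> by (intro power_mono) auto
    ultimately have "\<tau>\<^sup>2 * v\<^sup>2 \<le> 2\<^sup>2 * (25 / 16 * u\<^sup>2)" by (intro mult_mono) auto
    then show ?thesis by (simp add: power_mult_distrib)
  qed
  also have "1 + - \<tau> * v + 4 * (25 / 16 * u\<^sup>2) \<le> 1 - \<tau> * u + 11 * u\<^sup>2"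
  proof -
    have "2 * (\<tau> * u\<^sup>2) \<le> 2 * (2 * u\<^sup>2)" using \<tau> by (intro mult_left_mono mult_right_mono) auto
    then show ?thesis
      unfolding v_def right_diff_distrib minus_mult_left[symmetric] using zero_le_power2[of u] by linarith
  qed
  finally show ?thesis by simp
qed

text \<open>The shift 25 has no special meaning: it only has to be so large that the coefficient of
  \<open>1 / t\<^sup>2\<close> in the expansion of left minus right side (divided by the right one) is negative.\<close>

lemma shifted_powr_sum_le:
  fixes t \<tau> :: real
  assumes t: "t \<ge> 51" and \<tau>: "1 \<le> \<tau>" "\<tau> \<le> 2"
  shows "(t - 1/2) * ((t - 1/2)\<^sup>2 + 25) powr (- \<tau>) + (t + 1/2) * ((t + 1/2)\<^sup>2 + 25) powr (- \<tau>)
     \<le> 2 * t powr (1 - 2 * \<tau>)"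
proof -
  define h where "h = 1 / (2 * t)"
  have h: "0 < h" "h \<le> 1 / 102" using t by (auto simp: h_def field_simps)
  have th: "t * h = 1 / 2" using t by (simp add: h_def)
  \<comment> \<open>In terms of h the points are t(1 - h) and t(1 + h), and 101 = 1 + 4 * 25. The
    bound t \<ge> 51 gives 101 h \<le> 1.\<close>
  define u v where "u = - 2 * h + 101 * h\<^sup>2" and "v = 2 * h + 101 * h\<^sup>2"
  have h2: "0 \<le> 101 * h\<^sup>2" "101 * h\<^sup>2 \<le> h"
  proof -
    have "101 * h * h \<le> 1 * h" using h by (intro mult_right_mono) auto
    then show "101 * h\<^sup>2 \<le> h" by (simp add: power2_eq_square)
  qed simp
  have uv: "\<bar>u\<bar> \<le> 3 * h" "\<bar>v\<bar> \<le> 3 * h" using h h2 unfolding u_def v_def by linarith+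
  have "\<bar>u\<bar>\<^sup>2 \<le> (3 * h)\<^sup>2" "\<bar>v\<bar>\<^sup>2 \<le> (3 * h)\<^sup>2" using uv by (intro power_mono; simp)+
  then have sq: "u\<^sup>2 \<le> 9 * h\<^sup>2" "v\<^sup>2 \<le> 9 * h\<^sup>2" by (simp_all add: power_mult_distrib)
  have eu: "(t - 1/2)\<^sup>2 + 25 = t\<^sup>2 * (1 + u)"
  proof -
    have "t\<^sup>2 * (1 + u) = t\<^sup>2 - 2 * t * (t * h) + 101 * (t * h)\<^sup>2"
      by (simp add: u_def power2_eq_square algebra_simps)
    then show ?thesis unfolding th by (simp add: power2_eq_square algebra_simps)
  qed
  have ev: "(t + 1/2)\<^sup>2 + 25 = t\<^sup>2 * (1 + v)"
  proof -
    have "t\<^sup>2 * (1 + v) = t\<^sup>2 + 2 * t * (t * h) + 101 * (t * h)\<^sup>2"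
      by (simp add: v_def power2_eq_square algebra_simps)
    then show ?thesis unfolding th by (simp add: power2_eq_square algebra_simps)
  qed
  have pw: "(t\<^sup>2 * (1 + x)) powr (- \<tau>) = t powr (- 2 * \<tau>) * (1 + x) powr (- \<tau>)" if "\<bar>x\<bar> \<le> 3 * h" for x
  proof -
    have "(t\<^sup>2) powr (- \<tau>) = t powr (- 2 * \<tau>)"
      using t powr_powr[of t 2 "- \<tau>"] by simp
    then show ?thesis using t that h by (simp add: powr_mult)
  qed
  have "(1 - h) * (1 + u) powr (- \<tau>) + (1 + h) * (1 + v) powr (- \<tau>)
     \<le> (1 - h) * (1 - \<tau> * u + 11 * u\<^sup>2) + (1 + h) * (1 - \<tau> * v + 11 * v\<^sup>2)"
    using h uv \<tau> by (intro add_mono mult_left_mono powr_minus_le_quadratic) auto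
  also have "\<dots> \<le> (1 - h) * (1 - \<tau> * u + 11 * (9 * h\<^sup>2)) + (1 + h) * (1 - \<tau> * v + 11 * (9 * h\<^sup>2))"
    using sq h by (intro add_mono mult_left_mono) auto
  \<comment> \<open>The first-order terms in h cancel; 206 = 2 * 101 + 4 beats 198 = 2 * 99 once
    \<tau> \<ge> 1.\<close>
  also have "\<dots> = 2 - 206 * (\<tau> * h\<^sup>2) + 198 * h\<^sup>2"
    by (simp add: u_def v_def power2_eq_square algebra_simps)
  also have "\<dots> \<le> 2"
  proof -
    have "1 * h\<^sup>2 \<le> \<tau> * h\<^sup>2" using \<tau> by (intro mult_right_mono) auto
    then show ?thesis using zero_le_power2[of h] by linarith
  qed
  finally have main: "(1 - h) * (1 + u) powr (- \<tau>) + (1 + h) * (1 + v) powr (- \<tau>) \<le> 2" .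
  have "(t - 1/2) * ((t - 1/2)\<^sup>2 + 25) powr (- \<tau>) + (t + 1/2) * ((t + 1/2)\<^sup>2 + 25) powr (- \<tau>)
     = t * t powr (- 2 * \<tau>) * ((1 - h) * (1 + u) powr (- \<tau>) + (1 + h) * (1 + v) powr (- \<tau>))"
  proof -
    have e: "t - 1/2 = t * (1 - h)" "t + 1/2 = t * (1 + h)" using th by (simp_all add: algebra_simps)
    show ?thesis
      unfolding eu ev pw[OF uv(1)] pw[OF uv(2)] unfolding e by (simp add: algebra_simps)
  qed
  also have "\<dots> \<le> t * t powr (- 2 * \<tau>) * 2" using main t by (intro mult_left_mono) auto
  also have "t * t powr (- 2 * \<tau>) = t powr (1 - 2 * \<tau>)"
    using t powr_add[of t 1 "- 2 * \<tau>"] by simp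
  finally show ?thesis by simp
qed

text \<open>Midpoint convexity of x^(-a), obtained from (t - 1/2)(t + 1/2) \<le> t^2 and 2xy \<le>
  x^2 + y^2.\<close>

lemma powr_neg_midpoint_le:
  fixes t a :: real
  assumes t: "t > 1/2" and a: "a \<ge> 0"
  shows "2 * t powr (- a) \<le> (t - 1/2) powr (- a) + (t + 1/2) powr (- a)"
proof -
  define x y where "x = (t - 1/2) powr (- (a / 2))" and "y = (t + 1/2) powr (- (a / 2))"
  have "2 * t powr (- a) = 2 * (t\<^sup>2) powr (- (a / 2))"
    using t by (simp add: powr_numeral[symmetric] powr_powr del: powr_numeral)
  also have "\<dots> \<le> 2 * ((t - 1/2) * (t + 1/2)) powr (- (a / 2))"
  proof -
    have "0 < (t - 1/2) * (t + 1/2)" using t by simp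
    moreover have "(t - 1/2) * (t + 1/2) \<le> t\<^sup>2" by (simp add: power2_eq_square algebra_simps)
    ultimately show ?thesis using a by (simp add: powr_mono2')
  qed
  also have "\<dots> = 2 * (x * y)" using t by (simp add: x_def y_def powr_mult)
  also have "\<dots> \<le> x\<^sup>2 + y\<^sup>2" using zero_le_power2[of "x - y"] by (simp add: power2_eq_square algebra_simps)
  also have "x\<^sup>2 = (t - 1/2) powr (- a)" by (simp add: x_def power2_eq_square powr_add[symmetric])
  also have "y\<^sup>2 = (t + 1/2) powr (- a)" by (simp add: y_def power2_eq_square powr_add[symmetric])
  finally show ?thesis .
qed

text \<open>The right side telescopes in steps of 2. The claim reads \<phi>(t + 1) \<le> \<phi>(t),
  since the values at t + 1/2 cancel, and \<phi> decreases by midpoint convexity of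
  x^(-s-1).\<close>

lemma powr_diff_le_midpoint_diff:
  fixes t s :: real
  assumes t: "t \<ge> 1" and s: "s > 0"
  shows "t powr (- s) - (t + 1) powr (- s) \<le>
     (t - 1/2) powr (- s) / 2 - (t + 2 - 1/2) powr (- s) / 2"
proof -
  define \<phi> where "\<phi> x = (x - 1/2) powr (- s) / 2 + (x + 1/2) powr (- s) / 2 - x powr (- s)" for x :: real
  have "\<phi> (t + 1) \<le> \<phi> t"
  proof (rule DERIV_nonpos_imp_nonincreasing[of t "t + 1" \<phi>])
    fix x assume x: "t \<le> x" "x \<le> t + 1"
    let ?d = "- s / 2 * ((x - 1/2) powr (- s - 1) + (x + 1/2) powr (- s - 1) - 2 * x powr (- s - 1))"
    have "(\<phi> has_real_derivative ?d) (at x)"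
      unfolding \<phi>_def using x t
      by (auto intro!: derivative_eq_intros simp: algebra_simps add_divide_distrib diff_divide_distrib)
    moreover have "?d \<le> 0"
      using powr_neg_midpoint_le[of x "s + 1"] x t s
      by (simp add: mult_nonneg_nonneg)
    ultimately show "\<exists>y. (\<phi> has_real_derivative y) (at x) \<and> y \<le> 0" by blast
  qed simp
  then show ?thesis by (simp add: \<phi>_def add.assoc) (simp add: algebra_simps)
qed

text \<open>The reverse comparison, for (m^2 + 25)^(-\<sigma>) instead of m^(-2\<sigma>): the shift
  overcompensates convexity. The derivative of \<phi> is controlled by
  \<open>shifted_powr_sum_le\<close> with \<tau> = \<sigma> + 1.\<close>

lemma shifted_diff_le_powr_diff:
  fixes t \<sigma> :: real
  assumes t: "t \<ge> 51" and \<sigma>: "0 < \<sigma>" "\<sigma> \<le> 1"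
  shows "((t - 1/2)\<^sup>2 + 25) powr (- \<sigma>) / 2 - ((t + 2 - 1/2)\<^sup>2 + 25) powr (- \<sigma>) / 2
     \<le> t powr (- 2 * \<sigma>) - (t + 1) powr (- 2 * \<sigma>)"
proof -
  define \<phi> where "\<phi> x = x powr (- 2 * \<sigma>) - ((x - 1/2)\<^sup>2 + 25) powr (- \<sigma>) / 2
      - ((x + 1/2)\<^sup>2 + 25) powr (- \<sigma>) / 2" for x :: real
  have pos: "0 < y\<^sup>2 + (25::real)" for y by (simp add: add_nonneg_pos)
  have "\<phi> (t + 1) \<le> \<phi> t"
  proof (rule DERIV_nonpos_imp_nonincreasing[of t "t + 1" \<phi>])
    fix x assume x: "t \<le> x" "x \<le> t + 1"
    let ?d = "\<sigma> * ((x - 1/2) * ((x - 1/2)\<^sup>2 + 25) powr (- \<sigma> - 1)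
        + (x + 1/2) * ((x + 1/2)\<^sup>2 + 25) powr (- \<sigma> - 1) - 2 * x powr (- 2 * \<sigma> - 1))"
    have "((\<lambda>x. ((x + c)\<^sup>2 + 25) powr (- \<sigma>) / 2) has_real_derivative
        - \<sigma> * ((x + c) * ((x + c)\<^sup>2 + 25) powr (- \<sigma> - 1))) (at x)" for c
      by (auto intro!: derivative_eq_intros simp: pos)
    from this[of "- 1/2"] this[of "1/2"]
    have "(\<phi> has_real_derivative (- 2 * \<sigma>) * x powr (- 2 * \<sigma> - 1)
        - (- \<sigma> * ((x - 1/2) * ((x - 1/2)\<^sup>2 + 25) powr (- \<sigma> - 1)))
        - (- \<sigma> * ((x + 1/2) * ((x + 1/2)\<^sup>2 + 25) powr (- \<sigma> - 1)))) (at x)"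
      unfolding \<phi>_def using x t
      by (intro DERIV_diff) (auto intro!: derivative_eq_intros)
    then have "(\<phi> has_real_derivative ?d) (at x)" by (simp add: algebra_simps)
    moreover have "?d \<le> 0"
    proof (rule mult_nonneg_nonpos)
      have "- (\<sigma> + 1) = - \<sigma> - 1" "1 - 2 * (\<sigma> + 1) = - 2 * \<sigma> - 1" by (simp_all add: algebra_simps)
      then show "(x - 1/2) * ((x - 1/2)\<^sup>2 + 25) powr (- \<sigma> - 1)
        + (x + 1/2) * ((x + 1/2)\<^sup>2 + 25) powr (- \<sigma> - 1) - 2 * x powr (- 2 * \<sigma> - 1) \<le> 0"
        using shifted_powr_sum_le[of x "\<sigma> + 1"] x t \<sigma> by (simp only:) linarith
    qed (use \<sigma> in simp)
    ultimately show "\<exists>y. (\<phi> has_real_derivative y) (at x) \<and> y \<le> 0" by blast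
  qed simp
  then show ?thesis by (simp add: \<phi>_def add.assoc) (simp add: algebra_simps)
qed

text \<open>The nonnegative terms are dominated by a telescoping series with sum \<open>g 0\<close>,
  giving summability and the bound together.\<close>

lemma A_ns_terms:
  fixes n :: nat and s :: real
  assumes n: "n \<ge> 1" and s: "s > 0"
  shows "summable (\<lambda>k. 1 / real (n + 2*k) powr s - 1 / real (n + 2*k + 1) powr s)"
    and "A_ns n s \<le> (real n - 1/2) powr (- s) / 2"
proof -
  define g where "g k = (real (n + 2*k) - 1/2) powr (- s) / 2" for k :: nat
  let ?a = "\<lambda>k. 1 / real (n + 2*k) powr s - 1 / real (n + 2*k + 1) powr s"
  have "g \<longlonglongrightarrow> 0 / 2"
    unfolding g_def
  proof (intro tendsto_divide tendsto_const tendsto_neg_powr)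
    show "filterlim (\<lambda>k. real (n + 2*k) - 1/2) at_top sequentially"
      by (rule filterlim_at_top_mono[OF filterlim_real_sequentially]) (use n in auto)
  qed (use s in auto)
  then have gs: "(\<lambda>k. g k - g (Suc k)) sums g 0"
    using telescope_sums'[of g 0] by simp
  have le: "?a k \<le> g k - g (Suc k)" for k
    using powr_diff_le_midpoint_diff[of "real (n + 2*k)" s] n s
    by (simp add: g_def powr_minus_divide algebra_simps)
  have pos: "0 \<le> ?a k" for k
  proof -
    have "real (n + 2*k) powr s \<le> real (n + 2*k + 1) powr s" using s by (intro powr_mono2) auto
    then show ?thesis using n by (simp add: frac_le)
  qed
  show sm: "summable ?a"
    using sums_summable[OF gs] by (rule summable_comparison_test') (use le pos in auto)
  have "A_ns n s \<le> g 0"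
    unfolding A_ns_def by (rule sums_le[OF le summable_sums[OF sm] gs])
  then show "A_ns n s \<le> (real n - 1/2) powr (- s) / 2" by (simp add: g_def)
qed

lemma A_ns_lower:
  fixes n :: nat and \<sigma> :: real
  assumes n: "n \<ge> 51" and \<sigma>: "0 < \<sigma>" "\<sigma> \<le> 1"
  shows "((real n - 1/2)\<^sup>2 + 25) powr (- \<sigma>) / 2 \<le> A_ns n (2 * \<sigma>)"
proof -
  define g where "g k = ((real (n + 2*k) - 1/2)\<^sup>2 + 25) powr (- \<sigma>) / 2" for k :: nat
  let ?a = "\<lambda>k. 1 / real (n + 2*k) powr (2 * \<sigma>) - 1 / real (n + 2*k + 1) powr (2 * \<sigma>)"
  have "g \<longlonglongrightarrow> 0 / 2"
    unfolding g_def
  proof (intro tendsto_divide tendsto_const tendsto_neg_powr)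
    show "filterlim (\<lambda>k. (real (n + 2*k) - 1/2)\<^sup>2 + 25) at_top sequentially"
    proof (rule filterlim_at_top_mono[OF filterlim_real_sequentially], rule always_eventually, rule allI)
      fix k
      have "real k \<le> real (n + 2*k) - 1/2" using n by simp
      also have "\<dots> \<le> (real (n + 2*k) - 1/2)\<^sup>2" using n by (intro self_le_power) auto
      finally show "real k \<le> (real (n + 2*k) - 1/2)\<^sup>2 + 25" by simp
    qed
  qed (use \<sigma> in auto)
  then have gs: "(\<lambda>k. g k - g (Suc k)) sums g 0"
    using telescope_sums'[of g 0] by simp
  have le: "g k - g (Suc k) \<le> ?a k" for k
    using shifted_diff_le_powr_diff[of "real (n + 2*k)" \<sigma>] n \<sigma>
    by (simp add: g_def powr_minus_divide algebra_simps)
  have "g 0 \<le> A_ns n (2 * \<sigma>)"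
    unfolding A_ns_def
    by (rule sums_le[OF le gs summable_sums[OF A_ns_terms(1)]]) (use n \<sigma> in auto)
  then show ?thesis by (simp add: g_def)
qed

lemma B_ns_eq: "n \<ge> 1 \<Longrightarrow> s > 0 \<Longrightarrow> B_ns n s = - A_ns n s"
  using suminf_minus[OF A_ns_terms(1)[of n s]] by (simp add: A_ns_def B_ns_def)

section \<open>The floor identities\<close>

text \<open>The left side has 2-adic valuation exactly p - 2 > 0; on the right k would be even and
  the valuation at least p.\<close>

lemma odd_square_times_power_neq_power:
  fixes y k :: int
  assumes p: "p \<ge> 3" and y: "odd y"
  shows "2 ^ (p - 2) * y\<^sup>2 \<noteq> k ^ p"
proof
  assume eq: "2 ^ (p - 2) * y\<^sup>2 = k ^ p"
  have "even (2 ^ (p - 2) * y\<^sup>2)" using p by simp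
  then have "even k" unfolding eq by simp
  then have "2 ^ p dvd k ^ p" by (rule dvd_power_same)
  moreover have "2 ^ p = (2 ^ (p - 2) * 2\<^sup>2 :: int)"
    unfolding power_add[symmetric] using p by (subst le_add_diff_inverse2) simp_all
  ultimately have "2 ^ (p - 2) * 2\<^sup>2 dvd 2 ^ (p - 2) * y\<^sup>2"
    unfolding eq by simp
  then have "2\<^sup>2 dvd y\<^sup>2" by (subst (asm) dvd_mult_cancel_left) simp
  then have "even (y\<^sup>2)" by (metis dvd_mult_left power2_eq_square)
  then show False using y by simp
qed

text \<open>Each difference d in 1..C is treated separately: multiplying by a = 2^(p-2) completes
  the square, with X = a y and D = a d.\<close>

lemma finite_near_powers:
  fixes p :: nat and C :: int
  assumes p: "p \<ge> 5"
  shows "finite {y :: int. odd y \<and> (\<exists>k>0. 0 \<le> k ^ p - 2 ^ (p - 2) * y\<^sup>2 \<and> k ^ p - 2 ^ (p - 2) * y\<^sup>2 \<le> C)}"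
    (is "finite ?Y")
proof -
  let ?a = "2 ^ (p - 2) :: int"
  let ?S = "\<lambda>d. {X :: int. \<exists>k>0. X\<^sup>2 + ?a * d = ?a * k ^ p}"
  have "(\<lambda>y. ?a * y) ` ?Y \<subseteq> (\<Union>d\<in>{1..C}. ?S d)"
  proof (rule image_subsetI)
    fix y assume "y \<in> ?Y"
    then obtain k where y: "odd y" and k: "k > 0" "0 \<le> k ^ p - ?a * y\<^sup>2" "k ^ p - ?a * y\<^sup>2 \<le> C"
      by blast
    define d where "d = k ^ p - ?a * y\<^sup>2"
    have "d \<noteq> 0" using odd_square_times_power_neq_power[of p y k] p y by (simp add: d_def)
    then have "d \<in> {1..C}" using k by (simp add: d_def)
    moreover have "(?a * y)\<^sup>2 + ?a * d = ?a * k ^ p"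
      by (simp add: d_def power2_eq_square algebra_simps)
    ultimately show "?a * y \<in> (\<Union>d\<in>{1..C}. ?S d)" using k(1) by blast
  qed
  moreover have "finite (\<Union>d\<in>{1..C}. ?S d)"
    using p by (intro finite_UN_I finite_solutions_square_plus_eq_power) auto
  ultimately have "finite ((\<lambda>y. ?a * y) ` ?Y)" by (rule finite_subset)
  then show ?thesis by (rule finite_imageD) (simp add: inj_on_def)
qed

text \<open>Raising an integer k in the gap to the p-th power puts k^p within 25 * 2^p above 2^p m^2
  = 2^(p-2) (2n - 1)^2, so 2n - 1 belongs to a finite set.\<close>

lemma no_integer_in_gap:
  fixes p :: nat
  assumes p: "p \<ge> 5"
  shows "\<exists>N. \<forall>n\<ge>N. \<forall>k :: int. \<not> (2 * (real n - 1/2) powr (2 / real p) \<le> of_int k \<and>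
      of_int k \<le> 2 * ((real n - 1/2)\<^sup>2 + 25) powr (1 / real p))"
proof -
  let ?Y = "{y :: int. odd y \<and> (\<exists>k>0. 0 \<le> k ^ p - 2 ^ (p - 2) * y\<^sup>2 \<and> k ^ p - 2 ^ (p - 2) * y\<^sup>2 \<le> 25 * 2 ^ p)}"
  have "bdd_above ?Y" using finite_near_powers[OF p] by (rule bdd_above_finite)
  then obtain b where b: "\<And>y. y \<in> ?Y \<Longrightarrow> y \<le> b" by (auto simp: bdd_above_def)
  have "\<not> (2 * (real n - 1/2) powr (2 / real p) \<le> of_int k \<and>
      of_int k \<le> 2 * ((real n - 1/2)\<^sup>2 + 25) powr (1 / real p))"
    if n: "n \<ge> Suc (nat b)" for n and k :: int
  proof
    define m where "m = real n - 1/2"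
    assume "2 * (real n - 1/2) powr (2 / real p) \<le> of_int k \<and>
      of_int k \<le> 2 * ((real n - 1/2)\<^sup>2 + 25) powr (1 / real p)"
    then have k: "2 * m powr (2 / real p) \<le> of_int k" "of_int k \<le> 2 * (m\<^sup>2 + 25) powr (1 / real p)"
      by (simp_all add: m_def)
    have m: "m > 0" using n by (simp add: m_def)
    have "0 < 2 * m powr (2 / real p)" using m by simp
    then have k0: "k > 0" using k(1) by linarith
    have root: "(x powr (c / real p)) ^ p = x powr c" if "x > 0" for x c
      using that p by (simp add: powr_realpow[symmetric] powr_powr)
    have lower: "2 ^ p * m\<^sup>2 \<le> of_int (k ^ p)"
    proof -
      have "2 ^ p * m\<^sup>2 = (2 * m powr (2 / real p)) ^ p"
        using m by (simp add: power_mult_distrib root powr_numeral)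
      also have "\<dots> \<le> of_int k ^ p" using k(1) by (intro power_mono) auto
      finally show ?thesis by simp
    qed
    have upper: "of_int (k ^ p) \<le> 2 ^ p * (m\<^sup>2 + 25)"
    proof -
      have "of_int (k ^ p) = (of_int k :: real) ^ p" by simp
      also have "\<dots> \<le> (2 * (m\<^sup>2 + 25) powr (1 / real p)) ^ p"
        using k(2) k0 by (intro power_mono) auto
      also have "\<dots> = 2 ^ p * (m\<^sup>2 + 25)"
        using m by (simp add: power_mult_distrib root add_pos_pos)
      finally show ?thesis .
    qed
    define y where "y = 2 * int n - 1"
    have "(2::real) ^ p = 2 ^ (p - 2) * 2\<^sup>2"
      unfolding power_add[symmetric] using p by (subst le_add_diff_inverse2) simp_all
    moreover have "of_int y = 2 * m" by (simp add: y_def m_def)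
    ultimately have my: "2 ^ p * m\<^sup>2 = of_int (2 ^ (p - 2) * y\<^sup>2)"
      by (simp add: power_mult_distrib)
    have "0 \<le> k ^ p - 2 ^ (p - 2) * y\<^sup>2"
      using lower unfolding my of_int_le_iff by simp
    moreover have "k ^ p - 2 ^ (p - 2) * y\<^sup>2 \<le> 25 * 2 ^ p"
    proof -
      have "of_int (k ^ p) \<le> (of_int (2 ^ (p - 2) * y\<^sup>2 + 25 * 2 ^ p) :: real)"
        using upper unfolding distrib_left my by simp
      then show ?thesis unfolding of_int_le_iff by simp
    qed
    ultimately have "y \<in> ?Y" using k0 by (auto simp: y_def)
    from b[OF this] show False using n by (simp add: y_def)
  qed
  then show ?thesis by blast
qed

text \<open>The witnesses are \<open>\<lfloor>y\<rfloor>\<close> and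
  \<open>\<lceil>x\<rceil>\<close>. Excluding both endpoints matters: y must not be an integer for
  the first claim, x not for the negated one.\<close>

lemma floor_eq_if_no_integer_between:
  fixes x y :: real
  assumes "x \<le> y" "\<And>k :: int. \<not> (x \<le> of_int k \<and> of_int k \<le> y)"
  shows "\<lfloor>y\<rfloor> = \<lfloor>x\<rfloor>" "\<lfloor>- y\<rfloor> = \<lfloor>- x\<rfloor>"
proof -
  show "\<lfloor>y\<rfloor> = \<lfloor>x\<rfloor>"
    using assms(1) assms(2)[of "\<lfloor>y\<rfloor>"] by linarith
  show "\<lfloor>- y\<rfloor> = \<lfloor>- x\<rfloor>"
    using assms(1) assms(2)[of "\<lceil>x\<rceil>"] unfolding floor_minus by linarith
qed

theorem theorem4p7:
  fixes p :: nat and s :: real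
  assumes "odd p" and "p \<ge> 5" and "s = 2 / real p"
  shows "\<exists>n0 n1 :: nat. n0 > 0 \<and> n1 > 0 \<and>
    (\<forall>n. even n \<and> n \<ge> n0 \<longrightarrow>
       \<lfloor>1 / A_ns n s\<rfloor> = \<lfloor>2 * (real n - 1/2) powr s\<rfloor>) \<and>
    (\<forall>n. odd n \<and> n \<ge> n1 \<longrightarrow>
       \<lfloor>1 / B_ns n s\<rfloor> = \<lfloor>- 2 * (real n - 1/2) powr s\<rfloor>)"
proof -
  obtain N where N: "\<And>n k. n \<ge> N \<Longrightarrow> \<not> (2 * (real n - 1/2) powr (2 / real p) \<le> of_int k \<and>
      of_int k \<le> 2 * ((real n - 1/2)\<^sup>2 + 25) powr (1 / real p))"
    using no_integer_in_gap[OF assms(2)] by blast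
  have s: "s > 0" using assms by simp
  \<comment> \<open>\<open>N\<close> keeps integers out of the gap; 51 is the range of the lower
    bound for \<open>A_ns\<close>, applied with \<sigma> = 1/p.\<close>
  have main: "\<lfloor>1 / A_ns n s\<rfloor> = \<lfloor>2 * (real n - 1/2) powr s\<rfloor> \<and>
      \<lfloor>1 / B_ns n s\<rfloor> = \<lfloor>- 2 * (real n - 1/2) powr s\<rfloor>" if n: "n \<ge> max N 51" for n
  proof -
    let ?m = "real n - 1/2"
    have m: "?m > 0" using n by simp
    have up: "A_ns n s \<le> ?m powr (- s) / 2"
      using n s by (intro A_ns_terms) auto
    have lo: "(?m\<^sup>2 + 25) powr (- (1 / real p)) / 2 \<le> A_ns n s"
      using A_ns_lower[of n "1 / real p"] n assms by simp
    have g: "0 < (?m\<^sup>2 + 25) powr (- (1 / real p)) / 2"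
      using add_nonneg_pos[of "?m\<^sup>2" 25] by simp
    then have A: "A_ns n s > 0" using lo by linarith
    have x: "2 * ?m powr s \<le> 1 / A_ns n s"
      using up A m by (simp add: powr_minus field_simps)
    have z: "1 / A_ns n s \<le> 2 * (?m\<^sup>2 + 25) powr (1 / real p)"
    proof -
      have "1 / A_ns n s \<le> 1 / ((?m\<^sup>2 + 25) powr (- (1 / real p)) / 2)"
        using lo g by (intro divide_left_mono mult_pos_pos A) auto
      also have "\<dots> = 2 * (?m\<^sup>2 + 25) powr (1 / real p)"
        unfolding powr_minus by (simp only: inverse_eq_divide divide_divide_eq_right)
      finally show ?thesis .
    qed
    have "\<not> (2 * ?m powr s \<le> of_int k \<and> of_int k \<le> 1 / A_ns n s)" for k
      using N[of n k] n order_trans[OF _ z, of "of_int k"] unfolding assms(3) by auto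
    note floors = floor_eq_if_no_integer_between[OF x this]
    have "B_ns n s = - A_ns n s" using n s by (intro B_ns_eq) auto
    then show ?thesis using floors by simp
  qed
  show ?thesis
  proof (intro exI conjI allI impI)
    show "0 < max N 51" "0 < max N 51" by simp_all
  qed (use main in blast)+
qed

end
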